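(* For $n\ge 0$ let $B_n(t,q,Y_0,Y_1,Z)$ be defined by the identity of formal power series $$\sum_{n\ge0}(1+t)B_n(t,q,Y_0,Y_1,Z)\frac{u^n}{(t^2;q^2)_{n+1}}=\sum_{s\ge0}t^s\Bigl(1-u\sum_{i=0}^s q^iZ^{\chi(i\ \mathrm{odd})}\Bigr)^{-1}\frac{(u;q^2)_{\lfloor s/2\rfloor+1}}{(uY_0;q^2)_{\lfloor s/2\rfloor+1}}\,\frac{(-uqY_1Z;q^2)_{\lfloor (s+1)/2\rfloor}}{(-uqZ;q^2)_{\lfloor (s+1)/2\rfloor}}.$$ Then for every $n\ge 0$, $$B_n(t,q,Y_0,Y_1,Z)=\sum_{w\in B_n}t^{\mathrm{fdes}\,w}\,q^{\mathrm{fmaj}\,w}\,Y_0^{\mathrm{fix}^+w}\,Y_1^{\mathrm{fix}^-w}\,Z^{\mathrm{neg}\,w}.$$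
   Context: $(a;q)_0=1$ and $(a;q)_n=(1-a)(1-aq)\cdots(1-aq^{n-1})$ for $n\ge1$. For a statement $A$, $\chi(A)=1$ if $A$ is true and $0$ otherwise. $B_n$ is the set of signed permutations of order $n$: words $w=x_1\cdots x_n$ with $x_i\in\{-n,\dots,-1,1,\dots,n\}$ and $|x_1|\cdots|x_n|$ a permutation of $12\cdots n$. $\mathrm{neg}\,w$ is the number of negative letters; $\mathrm{fix}^+w=\#\{i>0: x_i=i\}$ and $\mathrm{fix}^-w=\#\{i>0: x_i=-i\}$. $\mathrm{des}\,w=\sum_{i=1}^{n-1}\chi(x_i>x_{i+1})$, $\mathrm{maj}\,w=\sum_{i=1}^{n-1}i\,\chi(x_i>x_{i+1})$ (usual order on integers), $\mathrm{fdes}\,w=2\,\mathrm{des}\,w+\chi(x_1<0)$ and $\mathrm{fmaj}\,w=2\,\mathrm{maj}\,w+\mathrm{neg}\,w$. *)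

theory Defs
  imports
    "HOL-Computational_Algebra.Formal_Power_Series"
    "HOL-Library.Groups_Big_Fun"
    "HOL-Library.Multiset"
begin

unbundle fps_syntax

section \<open>Signed permutations and their statistics\<close>

definition signed_perms :: "nat \<Rightarrow> int list set" where
  "signed_perms n =
     {w. set w \<subseteq> {- int n..-1} \<union> {1..int n} \<and> mset (map abs w) = mset [1..int n]}"

text \<open>Words are numbered from 1, as is customary for permutations; lists are numbered from 0.\<close>

definition letter :: "int list \<Rightarrow> nat \<Rightarrow> int" where
  "letter w i = w ! (i - 1)"

definition neg :: "int list \<Rightarrow> nat" where
  "neg w = card {i \<in> {1..length w}. letter w i < 0}"

definition fix_plus :: "int list \<Rightarrow> nat" where
  "fix_plus w = card {i \<in> {1..length w}. letter w i = int i}"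

definition fix_minus :: "int list \<Rightarrow> nat" where
  "fix_minus w = card {i \<in> {1..length w}. letter w i = - int i}"

definition des :: "int list \<Rightarrow> nat" where
  "des w = (\<Sum>i\<in>{1..<length w}. of_bool (letter w i > letter w (i + 1)))"

definition maj :: "int list \<Rightarrow> nat" where
  "maj w = (\<Sum>i\<in>{1..<length w}. i * of_bool (letter w i > letter w (i + 1)))"

text \<open>The empty word has no first letter, so it contributes 0 to the last summand.\<close>

definition fdes :: "int list \<Rightarrow> nat" where
  "fdes w = 2 * des w + of_bool (w \<noteq> [] \<and> letter w 1 < 0)"

definition fmaj :: "int list \<Rightarrow> nat" where
  "fmaj w = 2 * maj w + neg w"


section \<open>Formal power series in two variables\<close>

text \<open>
  The ring of formal power series in \<open>t\<close> and \<open>u\<close> over \<open>K\<close> is represented as \<open>K[[t]][[u]]\<close>: for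
  \<open>f :: 'a fps fps\<close> the coefficient of \<open>u ^ i * t ^ j\<close> is \<open>f $ i $ j\<close>.
\<close>

definition var_u :: "'a::comm_ring_1 fps fps" where
  "var_u = fps_X"

definition var_t :: "'a::comm_ring_1 fps fps" where
  "var_t = fps_const fps_X"

definition scalar :: "'a::comm_ring_1 \<Rightarrow> 'a fps fps" where
  "scalar c = fps_const (fps_const c)"

definition qpoch :: "'a::comm_ring_1 \<Rightarrow> 'a \<Rightarrow> nat \<Rightarrow> 'a" where
  "qpoch a q n = (\<Prod>k<n. 1 - a * q ^ k)"

text \<open>
  Infinite sums of bivariate series are taken coefficientwise. The library's notion of convergence
  on \<open>'a fps fps\<close> is of no use here: it is the \<open>u\<close>-adic one, for which the sum of the powers of
  \<open>t\<close> diverges.  \<open>Sum_any\<close> is the sum over all indices of a finitely supported family (and 0 for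
  any other family); that the families in question are finitely supported is shown below.
\<close>

definition formally_summable :: "(nat \<Rightarrow> 'a::comm_monoid_add fps fps) \<Rightarrow> bool" where
  "formally_summable f \<longleftrightarrow> (\<forall>i j. finite {k. f k $ i $ j \<noteq> 0})"

definition formal_sum :: "(nat \<Rightarrow> 'a::comm_monoid_add fps fps) \<Rightarrow> 'a fps fps" where
  "formal_sum f = Abs_fps (\<lambda>i. Abs_fps (\<lambda>j. Sum_any (\<lambda>k. f k $ i $ j)))"


section \<open>The defining identity\<close>

text \<open>
  All series that are inverted have constant term 1. The parameters range over arbitrary elements
  of an arbitrary field; indeterminates are the case of a field of rational functions.
\<close>

definition lhs_term :: "'a::field \<Rightarrow> (nat \<Rightarrow> 'a fps) \<Rightarrow> nat \<Rightarrow> 'a fps fps" where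
  "lhs_term q B n =
     (1 + var_t) * fps_const (B n) * var_u ^ n
       * inverse (qpoch (var_t\<^sup>2) ((scalar q)\<^sup>2) (n + 1))"

definition rhs_term :: "'a::field \<Rightarrow> 'a \<Rightarrow> 'a \<Rightarrow> 'a \<Rightarrow> nat \<Rightarrow> 'a fps fps" where
  "rhs_term q Y0 Y1 Z s =
     var_t ^ s
       * inverse (1 - var_u * (\<Sum>i=0..s. scalar q ^ i * scalar Z ^ of_bool (odd i)))
       * (qpoch var_u ((scalar q)\<^sup>2) (s div 2 + 1)
          * inverse (qpoch (var_u * scalar Y0) ((scalar q)\<^sup>2) (s div 2 + 1)))
       * (qpoch (- var_u * scalar q * scalar Y1 * scalar Z) ((scalar q)\<^sup>2) ((s + 1) div 2)
          * inverse (qpoch (- var_u * scalar q * scalar Z) ((scalar q)\<^sup>2) ((s + 1) div 2)))"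

definition gf_identity :: "'a::field \<Rightarrow> 'a \<Rightarrow> 'a \<Rightarrow> 'a \<Rightarrow> (nat \<Rightarrow> 'a fps) \<Rightarrow> bool" where
  "gf_identity q Y0 Y1 Z B \<longleftrightarrow>
     formal_sum (lhs_term q B) = formal_sum (rhs_term q Y0 Y1 Z)"


section \<open>The identity does define a sequence\<close>

lemma qpoch_var_t:
  "qpoch (var_t\<^sup>2) ((scalar q)\<^sup>2) n = fps_const (qpoch (fps_X\<^sup>2) ((fps_const q)\<^sup>2) n)"
proof -
  have "fps_const (\<Prod>k<n. g k) = (\<Prod>k<n. fps_const (g k))" for g :: "nat \<Rightarrow> 'a fps"
    by (induction n) (simp_all flip: fps_const_mult)
  then show ?thesis
    by (simp add: qpoch_def var_t_def scalar_def fps_const_power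
             flip: fps_const_mult fps_const_sub)
qed

lemma qpoch_fps_X_0: "qpoch (fps_X\<^sup>2) ((fps_const q)\<^sup>2) n $ 0 = (1 :: 'a::field)"
  by (induction n) (simp_all add: qpoch_def power2_eq_square)

lemma lhs_term_nth:
  "lhs_term q B n $ i =
     (if i = n then (1 + fps_X) * B n * inverse (qpoch (fps_X\<^sup>2) ((fps_const q)\<^sup>2) (n + 1)) else 0)"
proof -
  have "lhs_term q B n =
      fps_const ((1 + fps_X) * B n * inverse (qpoch (fps_X\<^sup>2) ((fps_const q)\<^sup>2) (n + 1)))
        * var_u ^ n"
    by (simp only: lhs_term_def qpoch_var_t fps_const_inverse)
       (simp add: var_t_def mult_ac flip: fps_const_mult fps_const_add)
  then show ?thesis by (simp add: var_u_def fps_X_power_nth)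
qed

lemma formally_summable_lhs: "formally_summable (lhs_term q B)"
  by (auto simp: formally_summable_def lhs_term_nth)

lemma formally_summable_rhs: "formally_summable (rhs_term q Y0 Y1 Z)"
  unfolding formally_summable_def
proof (intro allI)
  fix i j
  have "rhs_term q Y0 Y1 Z k $ i $ j = 0" if "j < k" for k
    using that by (simp add: rhs_term_def var_t_def mult.assoc fps_const_power fps_X_power_mult_nth)
  then have "{k. rhs_term q Y0 Y1 Z k $ i $ j \<noteq> 0} \<subseteq> {..j}" by (auto simp: not_less[symmetric])
  then show "finite {k. rhs_term q Y0 Y1 Z k $ i $ j \<noteq> 0}" by (rule finite_subset) simp
qed

lemma gf_identity_iff:
  "gf_identity q Y0 Y1 Z B \<longleftrightarrow>
     (\<forall>n. (1 + fps_X) * B n * inverse (qpoch (fps_X\<^sup>2) ((fps_const q)\<^sup>2) (n + 1))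
            = formal_sum (rhs_term q Y0 Y1 Z) $ n)"
proof -
  have "formal_sum (lhs_term q B) $ n =
      (1 + fps_X) * B n * inverse (qpoch (fps_X\<^sup>2) ((fps_const q)\<^sup>2) (n + 1))" for n
  proof (rule fps_ext)
    fix j
    have "Sum_any (\<lambda>k. lhs_term q B k $ n $ j) = (\<Sum>k\<in>{n}. lhs_term q B k $ n $ j)"
      by (rule Sum_any.expand_superset) (auto simp: lhs_term_nth)
    then show "formal_sum (lhs_term q B) $ n $ j =
      ((1 + fps_X) * B n * inverse (qpoch (fps_X\<^sup>2) ((fps_const q)\<^sup>2) (n + 1))) $ j"
      by (simp add: formal_sum_def lhs_term_nth)
  qed
  then show ?thesis by (auto simp: gf_identity_def fps_eq_iff)
qed

lemma gf_identity_ex1: "\<exists>!B. gf_identity q Y0 Y1 Z B"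
proof -
  define c where
    "c n = (1 + fps_X) * inverse (qpoch (fps_X\<^sup>2) ((fps_const q)\<^sup>2) (n + 1))" for n
  have c: "c n * inverse (c n) = 1" for n
    by (rule inverse_mult_eq_1') (simp add: c_def qpoch_fps_X_0 del: fps_const_power)
  define R where "R = formal_sum (rhs_term q Y0 Y1 Z)"
  have "c n * b = R $ n \<longleftrightarrow> b = inverse (c n) * R $ n" for n b
    using c[of n] by (metis (no_types, lifting) mult.assoc mult.commute mult_1)
  then have "gf_identity q Y0 Y1 Z B \<longleftrightarrow> B = (\<lambda>n. inverse (c n) * R $ n)" for B
    by (simp add: gf_identity_iff R_def c_def mult_ac fun_eq_iff)
  then show ?thesis by simp
qed

end

theory Submission
  imports Defs "HOL-Library.Product_Lexorder"
begin

text \<open>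
  MacMahon's Verfahren turns the coefficient of \<open>t ^ s\<close> in
  \<open>(1 + t) * t ^ fdes w * q ^ fmaj w / (t\<^sup>2; q\<^sup>2)\<^bsub>n+1\<^esub>\<close> into a sum over the sequences
  \<open>s \<ge> c\<^sub>1 \<ge> \<dots> \<ge> c\<^sub>n \<ge> 0\<close> that are strict at the descents of \<open>w\<close> and have \<open>c\<^sub>i\<close> odd exactly when
  \<open>w\<^sub>i < 0\<close>. A pair \<open>(w, c)\<close> is the same as a word \<open>v\<close> over \<open>{0, \<dots>, s}\<close>, by writing \<open>c\<^sub>i\<close> at position
  \<open>\<bar>w\<^sub>i\<bar>\<close>, so that without the fixed points the sum over all pairs is \<open>1 / (1 - u * (\<Sum>i\<le>s. x\<^sub>i))\<close>.

  Deleting a fixed point of \<open>w\<close> together with its \<open>c\<^sub>i = a\<close> deletes the letter \<open>a\<close> from \<open>v\<close> and leaves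
  all other fixed points alone. Conversely, within the increasing block of \<open>w\<close> on which \<open>c\<close> equals \<open>a\<close>
  there is exactly one way to insert a new fixed point if \<open>a\<close> is even. If \<open>a\<close> is odd, then the block is
  negative, \<open>\<bar>w\<^sub>i\<bar> - i\<close> is strictly decreasing on it, and the insertion is possible, in exactly one way,
  unless the block already has a fixed point. Hence marking the fixed points in the block of \<open>a\<close> by \<open>y\<close>
  multiplies the generating function by \<open>(1 - x\<^sub>a * u) / (1 - x\<^sub>a * y * u)\<close> or
  \<open>(1 + x\<^sub>a * y * u) / (1 + x\<^sub>a * u)\<close>, respectively.
\<close>

section \<open>Inserting and deleting fixed letters\<close>

definition signed_letter :: "nat list \<Rightarrow> nat \<Rightarrow> int" where
  "signed_letter v k = (if even (v ! k) then int k + 1 else - (int k + 1))"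

text \<open>Lexicographically, this key puts larger entries first and makes the letters increase
  within a block of equal entries: sorting by it produces the signed permutation.\<close>

definition pos_key :: "nat list \<Rightarrow> nat \<Rightarrow> int \<times> int" where
  "pos_key v k = (- int (v ! k), signed_letter v k)"

text \<open>
  Counted from 0: \<open>rank v k\<close> is the index at which the letter \<open>\<plusminus>(k + 1)\<close> appears in the signed
  permutation encoded by \<open>v\<close>.
\<close>

definition rank :: "nat list \<Rightarrow> nat \<Rightarrow> nat" where
  "rank v k = card {j. j < length v \<and> pos_key v j < pos_key v k}"

definition insert_at :: "nat \<Rightarrow> 'a \<Rightarrow> 'a list \<Rightarrow> 'a list" where
  "insert_at p a v = take p v @ a # drop p v"

definition delete_at :: "nat \<Rightarrow> 'a list \<Rightarrow> 'a list" where
  "delete_at p v = take p v @ drop (Suc p) v"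

definition skip :: "nat \<Rightarrow> nat \<Rightarrow> nat" where
  "skip p k = (if k < p then k else Suc k)"

lemma inj_skip: "inj (skip p)"
  by (auto simp: inj_def skip_def split: if_splits)

lemma skip_neq [simp]: "skip p k \<noteq> p" "p \<noteq> skip p k"
  by (auto simp: skip_def)

lemma lessThan_Suc_skip:
  assumes "p \<le> n"
  shows "{..<Suc n} = insert p (skip p ` {..<n})"
proof (rule set_eqI)
  fix k
  have "k \<in> skip p ` {..<n}" if "k < Suc n" "k \<noteq> p"
    using that assms by (intro image_eqI[of _ _ "if k < p then k else k - 1"]) (auto simp: skip_def)
  then show "k \<in> {..<Suc n} \<longleftrightarrow> k \<in> insert p (skip p ` {..<n})"
    using assms by (auto simp: skip_def)
qed

lemma length_insert_at [simp]: "length (insert_at p a v) = Suc (length v)"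
  by (simp add: insert_at_def)

lemma set_insert_at [simp]: "set (insert_at p a v) = insert a (set v)"
  by (metis Un_insert_right append_take_drop_id insert_at_def list.simps(15) set_append)

lemma insert_at_nth_skip:
  assumes "p \<le> length v" "k < length v"
  shows "insert_at p a v ! skip p k = v ! k"
  using assms by (auto simp: insert_at_def skip_def nth_append min_def)

lemma insert_at_nth [simp]: "p \<le> length v \<Longrightarrow> insert_at p a v ! p = a"
  by (simp add: insert_at_def nth_append)

lemma delete_insert_at: "p \<le> length v \<Longrightarrow> delete_at p (insert_at p a v) = v"
  by (simp add: insert_at_def delete_at_def)

lemma insert_delete_at: "p < length v \<Longrightarrow> insert_at p (v ! p) (delete_at p v) = v"
  by (simp add: insert_at_def delete_at_def id_take_nth_drop[symmetric])

lemma length_delete_at: "p < length v \<Longrightarrow> length (delete_at p v) = length v - 1"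
  by (simp add: delete_at_def)

lemma set_delete_at: "set (delete_at p v) \<subseteq> set v"
  by (auto simp: delete_at_def dest: in_set_takeD in_set_dropD)

text \<open>Inside a run of the letter \<open>a\<close> the place of insertion leaves no
  trace.\<close>

lemma insert_at_run:
  assumes "p \<le> p'" "p' \<le> length v" "\<And>j. p \<le> j \<Longrightarrow> j < p' \<Longrightarrow> v ! j = a"
  shows "insert_at p a v = insert_at p' a v"
  using assms
proof (induction p' rule: dec_induct)
  case (step m)
  have "insert_at m a v = insert_at (Suc m) a v"
    using step by (simp add: insert_at_def take_Suc_conv_app_nth Cons_nth_drop_Suc[symmetric])
  with step show ?case by simp
qed simp

lemma delete_at_run:
  assumes "p \<le> p'" "p' < length v" "\<And>j. p \<le> j \<Longrightarrow> j \<le> p' \<Longrightarrow> v ! j = a"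
  shows "delete_at p v = delete_at p' v"
  using assms
proof (induction p' rule: dec_induct)
  case (step m)
  have "v ! m = v ! Suc m" using step by simp
  then have "delete_at m v = delete_at (Suc m) v"
    using step by (simp add: delete_at_def take_Suc_conv_app_nth Cons_nth_drop_Suc[symmetric])
  with step show ?case by simp
qed simp

section \<open>The order of positions and the effect of an insertion on ranks\<close>

lemma pos_key_eq_iff: "pos_key v i = pos_key v j \<longleftrightarrow> i = j"
  by (auto simp: pos_key_def signed_letter_def split: if_splits)

lemma pos_key_less_iff:
  "pos_key v i < pos_key v j \<longleftrightarrow>
     v ! j < v ! i \<or> v ! i = v ! j \<and> (if even (v ! j) then i < j else j < i)"
  by (auto simp: pos_key_def signed_letter_def)

lemma pos_key_insert_at:
  assumes "p \<le> length v" "i < length v" "j < length v"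
  shows "pos_key (insert_at p a v) (skip p i) < pos_key (insert_at p a v) (skip p j)
           \<longleftrightarrow> pos_key v i < pos_key v j"
  using assms by (auto simp: pos_key_less_iff insert_at_nth_skip)
      (auto simp: skip_def split: if_splits)

lemma rank_less:
  assumes "i < length v" "pos_key v i < pos_key v j"
  shows "rank v i < rank v j"
  unfolding rank_def using assms by (intro psubset_card_mono) auto

lemma rank_insert_at_skip:
  fixes a :: nat
  assumes "p \<le> length v" "k < length v"
  defines "w \<equiv> insert_at p a v"
  shows "rank w (skip p k) = rank v k + of_bool (pos_key w p < pos_key w (skip p k))"
proof -
  have "{j. j < length w \<and> pos_key w j < pos_key w (skip p k)} =
      {j \<in> {..<Suc (length v)}. pos_key w j < pos_key w (skip p k)}" by (auto simp: w_def)
  also have "\<dots> = skip p ` {j. j < length v \<and> pos_key v j < pos_key v k} \<union>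
      (if pos_key w p < pos_key w (skip p k) then {p} else {})"
    unfolding lessThan_Suc_skip[OF assms(1)] w_def using assms pos_key_insert_at[OF assms(1)] by auto
  finally have "rank w (skip p k) = card \<dots>" by (simp add: rank_def)
  also have "\<dots> = rank v k + of_bool (pos_key w p < pos_key w (skip p k))"
    by (subst card_Un_disjoint) (auto simp: rank_def card_image inj_on_subset[OF inj_skip])
  finally show ?thesis .
qed

text \<open>A fixed letter at \<open>p\<close> separates ranks as it separates positions: letters
  with larger key gain 1 and end above \<open>p\<close>, the others keep a rank below
  \<open>p\<close>. So rank and position are both transformed by the injective map
  \<open>skip p\<close>.\<close>

lemma fixed_insert_at_skip:
  assumes "p \<le> length v" "k < length v" and fixed: "rank (insert_at p a v) p = p"
  shows "rank (insert_at p a v) (skip p k) = skip p k \<longleftrightarrow> rank v k = k"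
proof -
  let ?w = "insert_at p a v"
  have len: "p < length ?w" "skip p k < length ?w" using assms by (auto simp: skip_def)
  note r = rank_insert_at_skip[OF assms(1,2), of a]
  consider "pos_key ?w p < pos_key ?w (skip p k)" | "pos_key ?w (skip p k) < pos_key ?w p"
    by (metis linorder_less_linear pos_key_eq_iff skip_neq(1))
  then show ?thesis
  proof cases
    case 1
    with rank_less[OF len(1) 1] r fixed show ?thesis by (auto simp: skip_def)
  next
    case 2
    then have "\<not> pos_key ?w p < pos_key ?w (skip p k)" by simp
    with rank_less[OF len(2) 2] r fixed show ?thesis by (auto simp: skip_def)
  qed
qed

text \<open>
  The rank that a letter \<open>a\<close> acquires when it is inserted at position \<open>p\<close>. As \<open>p\<close> grows by one it moves
  by at most one, upwards for even \<open>a\<close> and downwards for odd \<open>a\<close>; this yields a fixed point \<open>p\<close>.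
\<close>

definition insert_rank :: "nat \<Rightarrow> nat list \<Rightarrow> nat \<Rightarrow> nat" where
  "insert_rank a v p = card {j. j < length v \<and> (a < v ! j \<or> v ! j = a \<and> (even a \<longleftrightarrow> j < p))}"

lemma rank_insert_at:
  assumes "p \<le> length v"
  shows "rank (insert_at p a v) p = insert_rank a v p"
proof -
  let ?w = "insert_at p a v"
  have key: "pos_key ?w (skip p j) < pos_key ?w p \<longleftrightarrow> a < v ! j \<or> v ! j = a \<and> (even a \<longleftrightarrow> j < p)"
    if "j < length v" for j
    using that assms by (auto simp: pos_key_less_iff insert_at_nth_skip)
      (auto simp: skip_def split: if_splits)
  have "{j. j < length ?w \<and> pos_key ?w j < pos_key ?w p} =
      {j \<in> {..<Suc (length v)}. pos_key ?w j < pos_key ?w p}" by auto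
  also have "\<dots> = skip p ` {j. j < length v \<and> (a < v ! j \<or> v ! j = a \<and> (even a \<longleftrightarrow> j < p))}"
    unfolding lessThan_Suc_skip[OF assms] using key by auto
  finally show ?thesis
    by (simp add: rank_def insert_rank_def card_image inj_on_subset[OF inj_skip])
qed

text \<open>For odd letters \<open>insert_rank\<close> counts the equal letters at or after
  \<open>p\<close>; the shift to \<open>Suc k\<close> keeps the letter at \<open>k\<close> from
  counting itself.\<close>

lemma rank_eq_insert_rank:
  "rank v k = insert_rank (v ! k) v (if even (v ! k) then k else Suc k)"
  unfolding rank_def insert_rank_def pos_key_less_iff by (rule arg_cong[of _ _ card]) auto

lemma insert_rank_even:
  assumes "even a" "p \<le> p'" "p' \<le> length v"
  shows "insert_rank a v p' = insert_rank a v p + card {j. p \<le> j \<and> j < p' \<and> v ! j = a}"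
proof -
  have "{j. j < length v \<and> (a < v ! j \<or> v ! j = a \<and> (even a \<longleftrightarrow> j < p'))} =
      {j. j < length v \<and> (a < v ! j \<or> v ! j = a \<and> (even a \<longleftrightarrow> j < p))} \<union>
      {j. p \<le> j \<and> j < p' \<and> v ! j = a}" (is "_ = ?A \<union> ?B")
    using assms by auto
  then have "insert_rank a v p' = card (?A \<union> ?B)" by (simp only: insert_rank_def)
  also have "\<dots> = card ?A + card ?B" using assms(1) by (intro card_Un_disjoint) auto
  finally show ?thesis by (simp only: insert_rank_def)
qed

lemma insert_rank_odd:
  assumes "odd a" "p \<le> p'" "p' \<le> length v"
  shows "insert_rank a v p = insert_rank a v p' + card {j. p \<le> j \<and> j < p' \<and> v ! j = a}"
proof -
  have "{j. j < length v \<and> (a < v ! j \<or> v ! j = a \<and> (even a \<longleftrightarrow> j < p))} =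
      {j. j < length v \<and> (a < v ! j \<or> v ! j = a \<and> (even a \<longleftrightarrow> j < p'))} \<union>
      {j. p \<le> j \<and> j < p' \<and> v ! j = a}" (is "_ = ?A \<union> ?B")
    using assms by auto
  then have "insert_rank a v p = card (?A \<union> ?B)" by (simp only: insert_rank_def)
  also have "\<dots> = card ?A + card ?B" using assms(1) by (intro card_Un_disjoint) auto
  finally show ?thesis by (simp only: insert_rank_def)
qed

text \<open>Between two fixed points of \<open>insert_rank\<close> its growth equals the distance,
  so each position passed must contribute an \<open>a\<close>.\<close>

lemma insert_rank_run:
  assumes "even a" "p \<le> p'" "p' \<le> length v" "insert_rank a v p = p" "insert_rank a v p' = p'"
    "p \<le> j" "j < p'"
  shows "v ! j = a"
proof -
  have "card {j. p \<le> j \<and> j < p' \<and> v ! j = a} = card {p..<p'}"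
    using insert_rank_even[OF assms(1-3)] assms(2,4,5) by simp
  then have "{j. p \<le> j \<and> j < p' \<and> v ! j = a} = {p..<p'}"
    by (intro card_subset_eq) auto
  moreover have "j \<in> {p..<p'}" using assms(6,7) by simp
  ultimately show ?thesis by blast
qed

section \<open>Where a letter can be inserted as a fixed point\<close>

definition has_fixed :: "nat \<Rightarrow> nat list \<Rightarrow> bool" where
  "has_fixed a v \<longleftrightarrow> (\<exists>k<length v. v ! k = a \<and> rank v k = k)"

text \<open>A discrete intermediate value argument at the least \<open>p\<close> where
  \<open>insert_rank a v p\<close> is at most \<open>p\<close>: only a fall from
  \<open>Suc m\<close> to \<open>m\<close> in the step from \<open>m\<close> to \<open>Suc m\<close>
  could miss equality.\<close>

lemma insert_position_exists:
  assumes "even a \<or> \<not> has_fixed a v"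
  shows "\<exists>p\<le>length v. rank (insert_at p a v) p = p"
proof -
  let ?g = "insert_rank a v"
  have le: "?g p \<le> length v" for p
    unfolding insert_rank_def by (rule order.trans[OF card_mono[of "{..<length v}"]]) auto
  define p where "p = (LEAST p. ?g p \<le> p)"
  have p: "?g p \<le> p" unfolding p_def by (rule LeastI) (rule le)
  have pn: "p \<le> length v" unfolding p_def by (rule Least_le) (rule le)
  have "?g p = p"
  proof (cases p)
    case 0
    with p show ?thesis by simp
  next
    case (Suc m)
    have m: "m < ?g m" using not_less_Least[of m "\<lambda>p. ?g p \<le> p"] Suc by (simp add: p_def[symmetric])
    have J: "{j. m \<le> j \<and> j < Suc m \<and> v ! j = a} = (if v ! m = a then {m} else {})"
      by (auto simp: le_less_Suc_eq)
    show ?thesis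
    proof (cases "even a")
      case True
      then show ?thesis using insert_rank_even[of a m "Suc m" v] Suc pn p m by simp
    next
      case False
      have "\<not> has_fixed a v" using False assms by simp
      \<comment> \<open>The fall happens only across an entry \<open>v ! m = a\<close>, whose own
        rank is the value after the fall; it would be a fixed \<open>a\<close>.\<close>
      moreover have "rank v m = ?g p" if "v ! m = a"
        using rank_eq_insert_rank[of v m] that False Suc by simp
      ultimately have "\<not> (v ! m = a \<and> ?g p = m)" using Suc pn by (auto simp: has_fixed_def)
      then show ?thesis
        using insert_rank_odd[of a m "Suc m" v] False Suc pn p m by (auto simp: J split: if_splits)
    qed
  qed
  with pn show ?thesis by (auto simp: rank_insert_at)
qed

text \<open>For even \<open>a\<close> two solutions enclose a run of \<open>a\<close>, so the words
  agree; for odd \<open>a\<close> a rank weakly decreasing in \<open>p\<close> can equal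
  \<open>p\<close> only once.\<close>

lemma insert_position_unique:
  assumes "p \<le> length v" "p' \<le> length v"
    and "rank (insert_at p a v) p = p" "rank (insert_at p' a v) p' = p'"
  shows "insert_at p a v = insert_at p' a v"
  using assms
proof (induction p p' rule: linorder_wlog)
  case (le p p')
  then have g: "insert_rank a v p = p" "insert_rank a v p' = p'" by (auto simp: rank_insert_at)
  show ?case
  proof (cases "even a")
    case True
    then show ?thesis using le g insert_rank_run[of a p p' v] by (intro insert_at_run) auto
  next
    case False
    then have "p = p'" using insert_rank_odd[of a p p' v] le g by simp
    then show ?thesis by simp
  qed
qed auto

text \<open>The weakly decreasing function \<open>insert_rank a v\<close> takes the value
  \<open>p\<close> at \<open>Suc p\<close>, which is possible for one \<open>p\<close> only.\<close>

lemma fixed_odd_unique: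
  assumes "p < length v" "p' < length v" "odd a" "v ! p = a" "v ! p' = a" "rank v p = p" "rank v p' = p'"
  shows "p = p'"
  using assms
proof (induction p p' rule: linorder_wlog)
  case (le p p')
  then have "insert_rank a v (Suc p) = p" "insert_rank a v (Suc p') = p'"
    using rank_eq_insert_rank[of v p] rank_eq_insert_rank[of v p'] by auto
  then show ?case using insert_rank_odd[of a "Suc p" "Suc p'" v] le by simp
qed auto

lemma delete_position_unique:
  assumes "p < length v" "p' < length v" "v ! p = a" "v ! p' = a" "rank v p = p" "rank v p' = p'"
  shows "delete_at p v = delete_at p' v"
  using assms
proof (induction p p' rule: linorder_wlog)
  case (le p p')
  show ?case
  proof (cases "even a")
    case True
    then have g: "insert_rank a v p = p" "insert_rank a v p' = p'"
      using rank_eq_insert_rank[of v p] rank_eq_insert_rank[of v p'] le by auto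
    show ?thesis
      using True le g insert_rank_run[of a p p' v] by (intro delete_at_run) (auto simp: le_less)
  next
    case False
    then show ?thesis using fixed_odd_unique[of p v p' a] le by simp
  qed
qed auto

section \<open>Weighted words and their rational generating function\<close>

definition words :: "nat \<Rightarrow> nat \<Rightarrow> nat list set" where
  "words s n = {v. set v \<subseteq> {..s} \<and> length v = n}"

lemma finite_words [simp]: "finite (words s n)"
  unfolding words_def by (rule finite_lists_length_eq) simp

text \<open>The marker \<open>y\<close> of fixed points depends on the letter so that it can be set
  to 1 for one letter after another.\<close>

definition weight :: "(nat \<Rightarrow> 'b::comm_ring_1) \<Rightarrow> (nat \<Rightarrow> 'b) \<Rightarrow> nat list \<Rightarrow> 'b" where
  "weight x y v = (\<Prod>k<length v. x (v ! k) * (if rank v k = k then y (v ! k) else 1))"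

lemma weight_insert_at:
  assumes "p \<le> length v" "rank (insert_at p a v) p = p"
  shows "weight x y (insert_at p a v) = x a * y a * weight x y v"
proof -
  let ?w = "insert_at p a v"
  let ?f = "\<lambda>k. x (?w ! k) * (if rank ?w k = k then y (?w ! k) else 1)"
  have "weight x y ?w = prod ?f (insert p (skip p ` {..<length v}))"
    by (simp add: weight_def lessThan_Suc_skip[OF assms(1)] del: lessThan_Suc)
  also have "\<dots> = ?f p * (\<Prod>k<length v. ?f (skip p k))"
    by (subst prod.insert) (auto simp: prod.reindex inj_on_subset[OF inj_skip])
  also have "(\<Prod>k<length v. ?f (skip p k)) = weight x y v"
    unfolding weight_def using assms
    by (intro prod.cong) (auto simp: insert_at_nth_skip fixed_insert_at_skip)
  finally show ?thesis using assms by simp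
qed

text \<open>Deleting a fixed \<open>a\<close> and inserting one are inverse bijections of words,
  although for even \<open>a\<close> the position need not be determined. The choices made by
  \<open>SOME\<close> are harmless because the resulting word does not depend on them.\<close>

lemma sum_weight_fixed:
  assumes "a \<le> s"
  shows "(\<Sum>w \<in> {w \<in> words s (Suc n). has_fixed a w}. weight x y w) =
    x a * y a * (\<Sum>v \<in> {v \<in> words s n. even a \<or> \<not> has_fixed a v}. weight x y v)"
proof -
  define pos where "pos v = (SOME p. p \<le> length v \<and> rank (insert_at p a v) p = p)" for v
  define dpos where "dpos w = (SOME p. p < length w \<and> w ! p = a \<and> rank w p = p)" for w
  have pos: "pos v \<le> length v \<and> rank (insert_at (pos v) a v) (pos v) = pos v"
    if "even a \<or> \<not> has_fixed a v" for v
    unfolding pos_def by (rule someI_ex) (use insert_position_exists[OF that] in blast)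
  have dpos: "dpos w < length w \<and> w ! dpos w = a \<and> rank w (dpos w) = dpos w"
    if "has_fixed a w" for w
    unfolding dpos_def by (rule someI_ex) (use that in \<open>auto simp: has_fixed_def\<close>)
  have dins: "insert_at (dpos w) a (delete_at (dpos w) w) = w" if "has_fixed a w" for w
    using insert_delete_at[of "dpos w" w] dpos[OF that] by auto
  have fix_ins: "has_fixed a (insert_at (pos v) a v)" if "even a \<or> \<not> has_fixed a v" for v
    using pos[OF that] by (auto simp: has_fixed_def intro!: exI[of _ "pos v"])
  \<comment> \<open>A fixed \<open>a\<close> surviving the deletion would already be fixed in
    \<open>w\<close>, at a position other than \<open>p\<close>; an odd letter allows only
    one.\<close>
  have no_fix_del: "\<not> has_fixed a (delete_at (dpos w) w)" if "has_fixed a w" "odd a" for w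
  proof
    define p v where "p = dpos w" and "v = delete_at p w"
    have p: "p < length w" "w ! p = a" "rank w p = p" and w: "insert_at p a v = w"
      using dpos[OF that(1)] dins[OF that(1)] by (simp_all add: p_def v_def)
    assume "has_fixed a (delete_at (dpos w) w)"
    then obtain k where k: "k < length v" "v ! k = a" "rank v k = k"
      by (auto simp: has_fixed_def p_def v_def)
    have len: "length w = Suc (length v)" using p(1) by (simp add: v_def length_delete_at)
    then have le: "p \<le> length v" using p(1) by simp
    have "rank w (skip p k) = skip p k"
      using fixed_insert_at_skip[OF le k(1), of a] k(3) p(3) unfolding w by simp
    moreover have "w ! skip p k = a"
      using insert_at_nth_skip[OF le k(1), of a] k(2) unfolding w by simp
    moreover have "skip p k < length w" using k(1) len by (simp add: skip_def)
    ultimately have "skip p k = p" using p that(2) fixed_odd_unique[of "skip p k" w p a] by blast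
    then show False by simp
  qed
  have "(\<Sum>w \<in> {w \<in> words s (Suc n). has_fixed a w}. weight x y w) =
    (\<Sum>v \<in> {v \<in> words s n. even a \<or> \<not> has_fixed a v}. x a * y a * weight x y v)"
  proof (rule sum.reindex_bij_witness[of _ "\<lambda>v. insert_at (pos v) a v" "\<lambda>w. delete_at (dpos w) w"])
    fix w assume w: "w \<in> {w \<in> words s (Suc n). has_fixed a w}"
    then have hf: "has_fixed a w" by simp
    let ?v = "delete_at (dpos w) w"
    show *: "?v \<in> {v \<in> words s n. even a \<or> \<not> has_fixed a v}"
      using w dpos[OF hf] no_fix_del[OF hf] set_delete_at[of "dpos w" w]
      by (auto simp: words_def length_delete_at)
    then have p: "pos ?v \<le> length ?v \<and> rank (insert_at (pos ?v) a ?v) (pos ?v) = pos ?v"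
      by (intro pos) simp
    have d: "dpos w \<le> length ?v" "rank (insert_at (dpos w) a ?v) (dpos w) = dpos w"
      using dpos[OF hf] dins[OF hf] by (auto simp: length_delete_at)
    show "insert_at (pos ?v) a ?v = w"
      using insert_position_unique[of "pos ?v" ?v "dpos w" a] p d dins[OF hf] by simp
    show "x a * y a * weight x y ?v = weight x y w"
      using weight_insert_at[OF d, of x y] dins[OF hf] by simp
  next
    fix v assume v: "v \<in> {v \<in> words s n. even a \<or> \<not> has_fixed a v}"
    then have "even a \<or> \<not> has_fixed a v" by simp
    note p = pos[OF this] and f = fix_ins[OF this]
    let ?w = "insert_at (pos v) a v"
    show "?w \<in> {w \<in> words s (Suc n). has_fixed a w}"
      using v f assms by (auto simp: words_def)
    have "delete_at (dpos ?w) ?w = delete_at (pos v) ?w"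
      using dpos[OF f] p by (intro delete_position_unique[of _ _ _ a]) auto
    then show "delete_at (dpos ?w) ?w = v" using p by (simp add: delete_insert_at)
  qed
  then show ?thesis by (simp add: sum_distrib_left)
qed

text \<open>
  A fixed even letter can be inserted repeatedly, which gives a geometric series; a fixed odd letter
  can occur only once, which gives a factor \<open>1 + x a * y a * u\<close>.
\<close>

definition word_sum :: "nat \<Rightarrow> (nat \<Rightarrow> 'b::comm_ring_1) \<Rightarrow> (nat \<Rightarrow> 'b) \<Rightarrow> nat \<Rightarrow> 'b" where
  "word_sum s x y n = (\<Sum>v\<in>words s n. weight x y v)"

definition unfixed_sum :: "nat \<Rightarrow> (nat \<Rightarrow> 'b::comm_ring_1) \<Rightarrow> (nat \<Rightarrow> 'b) \<Rightarrow> nat \<Rightarrow> nat \<Rightarrow> 'b" where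
  "unfixed_sum s x y a n = (\<Sum>v \<in> {v \<in> words s n. \<not> has_fixed a v}. weight x y v)"

lemma words_0 [simp]: "words s 0 = {[]}"
  by (auto simp: words_def)

lemma word_sum_0 [simp]: "word_sum s x y 0 = 1"
  by (simp add: word_sum_def weight_def)

lemma unfixed_sum_0 [simp]: "unfixed_sum s x y a 0 = 1"
proof -
  have "{v \<in> words s 0. \<not> has_fixed a v} = {[]}" by (auto simp: has_fixed_def)
  then show ?thesis by (simp only: unfixed_sum_def) (simp add: weight_def)
qed

lemma word_sum_split:
  "word_sum s x y n = unfixed_sum s x y a n + (\<Sum>v \<in> {v \<in> words s n. has_fixed a v}. weight x y v)"
proof -
  have "words s n = {v \<in> words s n. \<not> has_fixed a v} \<union> {v \<in> words s n. has_fixed a v}" by blast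
  then have "word_sum s x y n = sum (weight x y) \<dots>" by (simp only: word_sum_def)
  also have "\<dots> = unfixed_sum s x y a n + (\<Sum>v \<in> {v \<in> words s n. has_fixed a v}. weight x y v)"
    unfolding unfixed_sum_def by (rule sum.union_disjoint) auto
  finally show ?thesis .
qed

lemma word_sum_Suc_even:
  assumes "a \<le> s" "even a"
  shows "word_sum s x y (Suc n) = unfixed_sum s x y a (Suc n) + x a * y a * word_sum s x y n"
  using word_sum_split[of s x y "Suc n" a] sum_weight_fixed[OF assms(1), of x y n] assms(2)
  by (simp add: word_sum_def)

lemma word_sum_Suc_odd:
  assumes "a \<le> s" "odd a"
  shows "word_sum s x y (Suc n) = unfixed_sum s x y a (Suc n) + x a * y a * unfixed_sum s x y a n"
  using word_sum_split[of s x y "Suc n" a] sum_weight_fixed[OF assms(1), of x y n] assms(2)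
  by (simp add: unfixed_sum_def)

text \<open>The marker \<open>y a\<close> never enters the weight of a word without a fixed
  \<open>a\<close>; this makes the series for \<open>y\<close> and \<open>y(a := 1)\<close>
  comparable.\<close>

lemma unfixed_sum_cong:
  assumes "\<And>b. b \<noteq> a \<Longrightarrow> y b = y' b"
  shows "unfixed_sum s x y a n = unfixed_sum s x y' a n"
  unfolding unfixed_sum_def
proof (rule sum.cong)
  fix v assume "v \<in> {v \<in> words s n. \<not> has_fixed a v}"
  then have "\<And>k. k < length v \<Longrightarrow> rank v k = k \<Longrightarrow> v ! k \<noteq> a" by (auto simp: has_fixed_def)
  then show "weight x y v = weight x y' v"
    unfolding weight_def by (intro prod.cong) (auto simp: assms)
qed simp

definition den_factor :: "(nat \<Rightarrow> 'b::comm_ring_1) \<Rightarrow> (nat \<Rightarrow> 'b) \<Rightarrow> nat \<Rightarrow> 'b fps" where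
  "den_factor x y a =
     (if even a then 1 - fps_const (x a * y a) * fps_X else 1 + fps_const (x a) * fps_X)"

definition num_factor :: "(nat \<Rightarrow> 'b::comm_ring_1) \<Rightarrow> (nat \<Rightarrow> 'b) \<Rightarrow> nat \<Rightarrow> 'b fps" where
  "num_factor x y a =
     (if even a then 1 - fps_const (x a) * fps_X else 1 + fps_const (x a * y a) * fps_X)"

text \<open>Both word series are expressed through the series \<open>?N\<close> of words without a
  fixed \<open>a\<close>, which is the same for \<open>y\<close> and \<open>y(a := 1)\<close>;
  eliminating \<open>?N\<close> gives the equation. It is cross-multiplied to avoid division in the
  coefficient ring.\<close>

lemma word_series_step:
  fixes x y :: "nat \<Rightarrow> 'b::comm_ring_1"
  assumes "a \<le> s"
  shows "Abs_fps (word_sum s x y) * den_factor x y a =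
    Abs_fps (word_sum s x (y(a := 1))) * num_factor x y a"
proof -
  let ?W = "\<lambda>y. Abs_fps (word_sum s x y)" and ?N = "\<lambda>y. Abs_fps (unfixed_sum s x y a)"
  have N: "?N (y(a := 1)) = ?N y"
    using unfixed_sum_cong[of a "y(a := 1)" y s x] by (simp add: fps_eq_iff)
  have even: "?W y * (1 - fps_const (x a * y a) * fps_X) = ?N y" if "even a" for y
  proof -
    have "?W y = ?N y + fps_const (x a * y a) * (fps_X * ?W y)"
    proof (rule fps_ext)
      fix n show "?W y $ n = (?N y + fps_const (x a * y a) * (fps_X * ?W y)) $ n"
        using word_sum_Suc_even[OF assms that, of x y] by (cases n) simp_all
    qed
    then show ?thesis by (simp add: algebra_simps)
  qed
  have odd: "?W y = ?N y * (1 + fps_const (x a * y a) * fps_X)" if "odd a" for y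
  proof (rule fps_ext)
    fix n
    have "?N y * (1 + fps_const (x a * y a) * fps_X) = ?N y + fps_const (x a * y a) * (fps_X * ?N y)"
      by (simp add: algebra_simps)
    then show "?W y $ n = (?N y * (1 + fps_const (x a * y a) * fps_X)) $ n"
      using word_sum_Suc_odd[OF assms that, of x y] by (cases n) simp_all
  qed
  show ?thesis
  proof (cases "even a")
    case True
    then show ?thesis using even[OF True, of y] even[OF True, of "y(a := 1)"] N
      by (simp add: den_factor_def num_factor_def)
  next
    case False
    then show ?thesis using odd[OF False, of y] odd[OF False, of "y(a := 1)"] N
      by (simp add: den_factor_def num_factor_def mult_ac)
  qed
qed

lemma word_series_prod:
  fixes x y :: "nat \<Rightarrow> 'b::comm_ring_1"
  assumes "m \<le> Suc s"
  shows "Abs_fps (word_sum s x y) * (\<Prod>a<m. den_factor x y a) =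
    Abs_fps (word_sum s x (\<lambda>a. if a < m then 1 else y a)) * (\<Prod>a<m. num_factor x y a)"
  using assms
proof (induction m)
  case (Suc m)
  let ?y = "\<lambda>a. if a < m then 1 else y a"
  have y: "?y(m := 1) = (\<lambda>a. if a < Suc m then 1 else y a)" by (auto simp: less_Suc_eq)
  have "m \<le> s" using Suc.prems by simp
  note step = word_series_step[OF this, of x ?y, unfolded y]
  have mult_step: "W * P = V * Q \<Longrightarrow> V * d = V' * c \<Longrightarrow> W * (P * d) = V' * (Q * c)"
    for W P V Q d V' c :: "'b fps"
    by (metis mult.assoc mult.commute)
  from Suc have "m \<le> Suc s" by simp
  note mult_step[OF Suc.IH[OF this] step]
  \<comment> \<open>The factors for \<open>m\<close> evaluate \<open>?y\<close> only at
    \<open>m\<close>, where it still equals \<open>y m\<close>.\<close>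
  then show ?case by (simp only: prod.lessThan_Suc den_factor_def num_factor_def less_irrefl if_False)
qed simp

lemma sum_prod_nth_words:
  fixes x :: "nat \<Rightarrow> 'b::comm_ring_1"
  shows "(\<Sum>v\<in>words s n. \<Prod>k<n. x (v ! k)) = (\<Sum>a\<le>s. x a) ^ n"
proof (induction n)
  case (Suc n)
  have W: "words s (Suc n) = (\<lambda>(a, v). a # v) ` ({..s} \<times> words s n)"
    by (auto simp: words_def length_Suc_conv image_iff)
  have inj: "inj_on (\<lambda>(a, v). a # v) ({..s} \<times> words s n)" by (auto simp: inj_on_def)
  have "(\<Sum>v\<in>words s (Suc n). \<Prod>k<Suc n. x (v ! k)) =
      (\<Sum>(a, v)\<in>{..s} \<times> words s n. x a * (\<Prod>k<n. x (v ! k)))"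
    unfolding W by (subst sum.reindex[OF inj])
      (simp add: case_prod_beta prod.lessThan_Suc_shift del: prod.lessThan_Suc)
  also have "\<dots> = (\<Sum>a\<le>s. x a) * (\<Sum>v\<in>words s n. \<Prod>k<n. x (v ! k))"
    by (simp add: sum_product sum.cartesian_product)
  finally show ?case by (simp add: Suc)
qed simp

text \<open>All letters are below \<open>Suc s\<close>, so every marker is 1 and the sum factors
  over the positions.\<close>

lemma word_sum_1: "word_sum s x (\<lambda>a. if a < Suc s then 1 else y a) n = (\<Sum>a\<le>s. x a) ^ n"
proof -
  have "weight x (\<lambda>a. if a < Suc s then 1 else y a) v = (\<Prod>k<n. x (v ! k))" if "v \<in> words s n" for v
  proof -
    have "v ! k < Suc s" if "k < n" for k
      using that \<open>v \<in> words s n\<close> by (auto simp: words_def less_Suc_eq_le dest!: nth_mem)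
    then show ?thesis using that by (auto simp: weight_def words_def intro!: prod.cong)
  qed
  then show ?thesis by (simp add: word_sum_def sum_prod_nth_words)
qed

lemma word_series:
  fixes x y :: "nat \<Rightarrow> 'b::comm_ring_1"
  shows "Abs_fps (word_sum s x y) * (1 - fps_const (\<Sum>a\<le>s. x a) * fps_X) *
      (\<Prod>a\<le>s. den_factor x y a) =
      (\<Prod>a\<le>s. num_factor x y a)"
proof -
  let ?A = "Abs_fps (\<lambda>n. (\<Sum>a\<le>s. x a) ^ n)"
  have "?A = 1 + fps_const (\<Sum>a\<le>s. x a) * (fps_X * ?A)"
  proof (rule fps_ext)
    fix n show "?A $ n = (1 + fps_const (\<Sum>a\<le>s. x a) * (fps_X * ?A)) $ n" by (cases n) simp_all
  qed
  then have "?A - fps_const (\<Sum>a\<le>s. x a) * (fps_X * ?A) = 1" by (metis add_diff_cancel_right')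
  then have A: "(1 - fps_const (\<Sum>a\<le>s. x a) * fps_X) * ?A = 1"
    by (simp only: left_diff_distrib mult_1 mult.assoc)
  have P: "Abs_fps (word_sum s x y) *
      (\<Prod>a\<le>s. den_factor x y a) =
    ?A * (\<Prod>a\<le>s. num_factor x y a)"
    using word_series_prod[of "Suc s" s x y, OF order_refl]
    unfolding ext[of "word_sum s x _", OF word_sum_1]
    by (simp only: lessThan_Suc_atMost)
  have "Abs_fps (word_sum s x y) * (1 - fps_const (\<Sum>a\<le>s. x a) * fps_X) * (\<Prod>a\<le>s. den_factor x y a) =
      (1 - fps_const (\<Sum>a\<le>s. x a) * fps_X) * (Abs_fps (word_sum s x y) * (\<Prod>a\<le>s. den_factor x y a))"
    by (simp only: mult_ac)
  then show ?thesis by (simp only: P mult.assoc[symmetric] A mult_1)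
qed

section \<open>MacMahon's Verfahren for one signed permutation\<close>

text \<open>\<open>box_sum Q n m\<close> is the sum of \<open>Q ^ (l\<^sub>1 + \<dots> + l\<^sub>n)\<close> over all \<open>m \<ge> l\<^sub>1 \<ge> \<dots> \<ge> l\<^sub>n \<ge> 0\<close>.\<close>

primrec box_sum :: "'b::comm_ring_1 \<Rightarrow> nat \<Rightarrow> nat \<Rightarrow> 'b" where
  "box_sum Q 0 m = 1"
| "box_sum Q (Suc n) m = (\<Sum>k\<le>m. Q ^ k * box_sum Q n k)"

lemma box_sum_0_right [simp]: "box_sum Q n 0 = 1"
  by (induction n) simp_all

text \<open>The Pascal rule for Gaussian binomials: either the smallest part is 0 and is dropped, or
  1 is subtracted from all \<open>Suc n\<close> parts. The recursion of \<open>box_sum\<close>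
  strips the largest part instead, hence the induction.\<close>

lemma box_sum_Suc_Suc:
  "box_sum Q (Suc n) (Suc m) = box_sum Q n (Suc m) + Q ^ Suc n * box_sum Q (Suc n) m"
proof (induction n arbitrary: m)
  case 0
  show ?case by (simp add: sum.atMost_Suc_shift sum_distrib_left del: sum.atMost_Suc)
next
  case (Suc n)
  have "box_sum Q (Suc (Suc n)) (Suc m) = 1 + (\<Sum>k\<le>m. Q ^ Suc k * box_sum Q (Suc n) (Suc k))"
    unfolding box_sum.simps(2)[of Q "Suc n"] by (subst sum.atMost_Suc_shift) simp
  also have "\<dots> = 1 + (\<Sum>k\<le>m. Q ^ Suc k * box_sum Q n (Suc k))
      + Q ^ Suc (Suc n) * (\<Sum>k\<le>m. Q ^ k * box_sum Q (Suc n) k)"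
    unfolding Suc.IH by (simp add: sum.distrib sum_distrib_left algebra_simps del: box_sum.simps)
  also have "1 + (\<Sum>k\<le>m. Q ^ Suc k * box_sum Q n (Suc k)) = box_sum Q (Suc n) (Suc m)"
    unfolding box_sum.simps(2)[of Q n] by (subst sum.atMost_Suc_shift) simp
  finally show ?case by (simp only: box_sum.simps(2)[of Q "Suc n"])
qed

text \<open>The expansion of \<open>1 / (z; Q)\<close> in Gaussian binomials at
  \<open>z = fps_X^2\<close>. The Pascal rule says that the factor \<open>1 - z * Q ^ Suc n\<close>
  lowers \<open>Suc n\<close> to \<open>n\<close>.\<close>

lemma box_series:
  fixes Q :: "'b::comm_ring_1"
  shows "Abs_fps (\<lambda>s. if even s then box_sum Q n (s div 2) else 0) *
    qpoch (fps_X\<^sup>2) (fps_const Q) (n + 1) = 1"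
proof (induction n)
  case 0
  let ?A = "Abs_fps (\<lambda>s. if even s then box_sum Q 0 (s div 2) else 0)"
  have "?A - fps_X\<^sup>2 * ?A = 1"
  proof (rule fps_ext)
    fix s show "(?A - fps_X\<^sup>2 * ?A) $ s = 1 $ s"
      by (cases "s < 2") (auto simp: fps_X_power_mult_nth less_2_cases_iff)
  qed
  then show ?case by (simp add: qpoch_def algebra_simps)
next
  case (Suc n)
  let ?A = "\<lambda>n. Abs_fps (\<lambda>s. if even s then box_sum Q n (s div 2) else 0)"
  have "?A (Suc n) - fps_const (Q ^ Suc n) * (fps_X\<^sup>2 * ?A (Suc n)) = ?A n"
  proof (rule fps_ext)
    fix s
    show "(?A (Suc n) - fps_const (Q ^ Suc n) * (fps_X\<^sup>2 * ?A (Suc n))) $ s = ?A n $ s"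
    proof (cases "even s \<and> 2 \<le> s")
      case True
      then obtain m where "s = 2 * Suc m"
        by (metis evenE mult_0_right not_numeral_le_zero not0_implies_Suc)
      then show ?thesis
        using box_sum_Suc_Suc[of Q n m] by (simp add: fps_X_power_mult_nth del: box_sum.simps power_Suc)
    next
      case False
      then show ?thesis
        by (cases "s < 2") (auto simp: fps_X_power_mult_nth less_2_cases_iff simp del: box_sum.simps)
    qed
  qed
  then have A: "?A (Suc n) * (1 - fps_X\<^sup>2 * fps_const Q ^ Suc n) = ?A n"
    by (simp only: fps_const_power right_diff_distrib left_diff_distrib mult_1 mult_1_right mult_ac)
  have "qpoch (fps_X\<^sup>2) (fps_const Q) (Suc n + 1) =
      (1 - fps_X\<^sup>2 * fps_const Q ^ Suc n) * qpoch (fps_X\<^sup>2) (fps_const Q) (n + 1)"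
    by (simp add: qpoch_def mult_ac)
  then show ?case by (simp only: mult.assoc[symmetric] A Suc.IH)
qed

text \<open>Lexicographic increase of the pairs says at once that \<open>c\<close> weakly decreases
  and that it drops wherever \<open>w\<close> does not rise; this is the order of
  \<open>pos_key\<close>. \<open>list_all2\<close> also forces equal lengths.\<close>

definition compatible :: "int list \<Rightarrow> nat list \<Rightarrow> bool" where
  "compatible w c \<longleftrightarrow> list_all2 (\<lambda>a x. odd a \<longleftrightarrow> x < 0) c w \<and>
     sorted_wrt (<) (zip (map (\<lambda>a. - int a) c) w)"

lemma compatible_Nil [simp]: "compatible [] c \<longleftrightarrow> c = []"
  by (auto simp: compatible_def)

lemma compatible_Cons:
  "compatible (x # w) (a # c) \<longleftrightarrow> (odd a \<longleftrightarrow> x < 0) \<and> compatible w c \<and>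
     (w \<noteq> [] \<longrightarrow> (- int a, x) < (- int (hd c), hd w))"
proof -
  have "transp ((<) :: int \<times> int \<Rightarrow> _)" by (rule transp_on_less)
  note s = sorted_wrt2[OF this]
  show ?thesis
    by (cases w; cases c)
      (auto simp: compatible_def s sorted_wrt1 simp del: sorted_wrt.simps(2) less_prod_simp)
qed

lemma compatible_le_hd:
  assumes "compatible w c" "a \<in> set c"
  shows "a \<le> hd c"
proof (cases w)
  case Nil
  with assms show ?thesis by simp
next
  case (Cons y w')
  with assms obtain h c' where c: "c = h # c'" by (cases c) auto
  show ?thesis
  proof (cases "a = h")
    case False
    with assms c obtain i where i: "i < length c'" "a = c' ! i" by (auto simp: in_set_conv_nth)
    have "length c' = length w'" using assms(1) Cons c by (auto simp: compatible_def list_all2_lengthD)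
    then have "(- int a, w' ! i) \<in> set (zip (map (\<lambda>a. - int a) c') w')"
      using i by (auto simp: set_zip intro!: exI[of _ i])
    then show ?thesis using assms(1) Cons c by (fastforce simp: compatible_def)
  qed (simp add: c)
qed

definition comps :: "nat \<Rightarrow> int list \<Rightarrow> nat list set" where
  "comps b w = {c. set c \<subseteq> {..<b} \<and> compatible w c}"

lemma finite_comps [simp]: "finite (comps b w)"
proof (rule finite_subset)
  show "comps b w \<subseteq> {c. set c \<subseteq> {..<b} \<and> length c = length w}"
    by (auto simp: comps_def compatible_def list_all2_lengthD)
qed (simp add: finite_lists_length_eq)

lemma comps_Nil [simp]: "comps b [] = {[]}"
  by (auto simp: comps_def)

text \<open>With an exclusive bound the condition on neighbours becomes a new bound: after a rise of
  \<open>w\<close> the next entry may equal \<open>a\<close>, otherwise it must be smaller. Adding 1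
  for \<open>w = []\<close> keeps the bound positive, as \<open>comp_sum_eq\<close>
  requires.\<close>

lemma comps_Cons:
  "comps b (x # w) =
    (\<Union>a\<in>{a. a < b \<and> (odd a \<longleftrightarrow> x < 0)}. (#) a ` comps (a + of_bool (w = [] \<or> x < hd w)) w)"
proof -
  have 1: "a # c \<in> comps b (x # w) \<longleftrightarrow>
      a < b \<and> (odd a \<longleftrightarrow> x < 0) \<and> c \<in> comps (a + of_bool (w = [] \<or> x < hd w)) w" for a c
  proof (cases w)
    case Nil
    then show ?thesis by (auto simp: comps_def compatible_Cons)
  next
    case (Cons y w')
    show ?thesis
    proof (cases "compatible w c")
      case True
      with Cons have "c \<noteq> []" by (auto simp: compatible_def)
      then have sub: "set c \<subseteq> {..<k} \<longleftrightarrow> hd c < k" for k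
        using compatible_le_hd[OF True] by (force simp: subset_iff)
      show ?thesis using Cons True by (auto simp: comps_def compatible_Cons sub)
    next
      case False
      then show ?thesis by (simp add: comps_def compatible_Cons)
    qed
  qed
  show ?thesis (is "_ = ?R")
  proof (rule set_eqI)
    fix c show "c \<in> comps b (x # w) \<longleftrightarrow> c \<in> ?R"
    proof (cases c)
      case Nil
      then show ?thesis by (auto simp: comps_def compatible_def)
    next
      case (Cons a c')
      then show ?thesis by (simp only: 1) auto
    qed
  qed
qed

definition comp_sum :: "'b::comm_ring_1 \<Rightarrow> nat \<Rightarrow> int list \<Rightarrow> 'b" where
  "comp_sum q b w = (\<Sum>c\<in>comps b w. q ^ sum_list c)"

lemma comp_sum_Nil [simp]: "comp_sum q b [] = 1"
  by (simp add: comp_sum_def)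

lemma comp_sum_Cons:
  "comp_sum q b (x # w) =
    (\<Sum>a | a < b \<and> (odd a \<longleftrightarrow> x < 0). q ^ a * comp_sum q (a + of_bool (w = [] \<or> x < hd w)) w)"
proof -
  have "comp_sum q b (x # w) = (\<Sum>a | a < b \<and> (odd a \<longleftrightarrow> x < 0).
      \<Sum>c\<in>(#) a ` comps (a + of_bool (w = [] \<or> x < hd w)) w. q ^ sum_list c)"
    unfolding comp_sum_def comps_Cons by (subst sum.UNION_disjoint) auto
  also have "\<dots> = (\<Sum>a | a < b \<and> (odd a \<longleftrightarrow> x < 0). q ^ a * comp_sum q (a + of_bool (w = [] \<or> x < hd w)) w)"
    by (simp add: sum.reindex comp_sum_def power_add sum_distrib_left)
  finally show ?thesis .
qed

section \<open>Recursions for the statistics and the sum over compatible sequences\<close>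

lemma letter_Cons_1 [simp]: "letter (x # w) (Suc 0) = x"
  by (simp add: letter_def)

lemma letter_Cons_Suc: "0 < i \<Longrightarrow> letter (x # w) (Suc i) = letter w i"
  by (cases i) (simp_all add: letter_def)

lemma des_Nil [simp]: "des [] = 0" and maj_Nil [simp]: "maj [] = 0" and neg_Nil [simp]: "neg [] = 0"
  by (simp_all add: des_def maj_def neg_def)

text \<open>Prepending a letter moves every descent of \<open>w\<close> one place to the right,
  adding 1 to \<open>maj\<close> for each; a new descent sits at place 1.\<close>

lemma descents_Cons:
  "des (x # w) = des w + of_bool (w \<noteq> [] \<and> x > hd w)" (is ?d)
  "maj (x # w) = maj w + des (x # w)" (is ?m)
proof -
  have S: "(\<Sum>i\<in>{1..<length (x # w)}. f i (letter (x # w) i) (letter (x # w) (i + 1))) =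
    (if w = [] then 0 else f 1 x (hd w)) + (\<Sum>i\<in>{1..<length w}. f (Suc i) (letter w i) (letter w (i + 1)))"
    for f :: "nat \<Rightarrow> int \<Rightarrow> int \<Rightarrow> nat"
  proof (cases w)
    case (Cons y w')
    have "(\<Sum>i\<in>{1..<length (x # w)}. f i (letter (x # w) i) (letter (x # w) (i + 1))) =
      f 1 x y + (\<Sum>i\<in>{Suc 1..<Suc (length w)}. f i (letter (x # w) i) (letter (x # w) (i + 1)))"
      using Cons by (subst sum.atLeast_Suc_lessThan) (simp_all add: letter_def)
    also have "(\<Sum>i\<in>{Suc 1..<Suc (length w)}. f i (letter (x # w) i) (letter (x # w) (i + 1))) =
      (\<Sum>i\<in>{1..<length w}. f (Suc i) (letter w i) (letter w (i + 1)))"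
      unfolding sum.shift_bounds_Suc_ivl by (rule sum.cong) (auto simp: letter_Cons_Suc)
    finally show ?thesis using Cons by simp
  qed simp
  show ?d unfolding des_def by (subst S) auto
  have "maj (x # w) = (if w = [] then 0 else of_bool (x > hd w)) +
      (\<Sum>i\<in>{1..<length w}. Suc i * of_bool (letter w i > letter w (i + 1)))"
    unfolding maj_def by (subst S) simp
  also have "\<dots> = (if w = [] then 0 else of_bool (x > hd w)) + (maj w + des w)"
    by (simp add: maj_def des_def sum.distrib add_ac)
  finally show ?m using \<open>?d\<close> by simp
qed

lemma neg_Cons: "neg (x # w) = neg w + of_bool (x < 0)"
proof -
  have "{i \<in> {1..length (x # w)}. letter (x # w) i < 0} =
      Suc ` {i \<in> {1..length w}. letter w i < 0} \<union> (if x < 0 then {1} else {})"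
  proof (rule set_eqI)
    fix i
    show "i \<in> {i \<in> {1..length (x # w)}. letter (x # w) i < 0} \<longleftrightarrow>
      i \<in> Suc ` {i \<in> {1..length w}. letter w i < 0} \<union> (if x < 0 then {1} else {})"
    proof (cases i)
      case (Suc j)
      then show ?thesis by (cases j) (auto simp: letter_def image_iff)
    qed auto
  qed
  then show ?thesis unfolding neg_def by (auto simp: card_image card_insert_if)
qed

lemma fdes_Cons: "fdes (x # w) = 2 * des (x # w) + of_bool (x < 0)"
  by (simp add: fdes_def)

text \<open>Iterated, this makes \<open>fmaj w\<close> the sum of \<open>fdes\<close> over the
  nonempty suffixes of \<open>w\<close>.\<close>

lemma fmaj_Cons: "fmaj (x # w) = fmaj w + fdes (x # w)"
  by (simp add: fmaj_def fdes_Cons descents_Cons neg_Cons)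

text \<open>
  The least compatible sequence is \<open>c\<^sub>i = 2 * (number of descents at or after i) + (1 if w\<^sub>i < 0)\<close>; it
  starts with \<open>fdes w\<close> and sums to \<open>fmaj w\<close>. Every other one differs from it by twice a partition.
\<close>

lemma comp_sum_eq:
  assumes "0 < b \<or> w \<noteq> []" "distinct w" "0 \<notin> set w"
  shows "comp_sum q b w =
    (if fdes w < b then q ^ fmaj w * box_sum (q\<^sup>2) (length w) ((b - 1 - fdes w) div 2) else 0)"
  using assms
proof (induction w arbitrary: b)
  case Nil
  then show ?case by (simp add: fdes_def fmaj_def)
next
  case (Cons x w)
  define d :: nat where "d = of_bool (w \<noteq> [] \<and> x > hd w)"
  define e :: nat where "e = of_bool (w = [] \<or> x < hd w)"
  define f where "f = fdes (x # w)"
  have ne: "w \<noteq> [] \<Longrightarrow> x \<noteq> hd w" "w \<noteq> [] \<Longrightarrow> hd w \<noteq> 0" "x \<noteq> 0"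
    using Cons.prems by (cases w; auto)+
  have f: "f = 2 * des w + 2 * d + of_bool (x < 0)"
    by (simp add: f_def fdes_Cons descents_Cons d_def)
  have fw: "fdes w = 2 * des w + of_bool (w \<noteq> [] \<and> hd w < 0)"
    by (cases w) (simp_all add: fdes_def)
  have ed: "e + d = 1" using ne by (auto simp: e_def d_def)
  \<comment> \<open>Consequently \<open>f\<close> is the least number of its parity with
    \<open>fdes w < f + e\<close>, so the admissible first entries are \<open>f\<close>,
    \<open>f + 2\<close>, and so on.\<close>
  have f_fw: "f + e = fdes w + 1 \<or> f + e = fdes w + 2"
    unfolding f fw using ne by (auto simp: e_def d_def)
  have odd_f: "odd f \<longleftrightarrow> x < 0" by (simp add: f)
  have IH: "comp_sum q (a + e) w =
      (if fdes w < a + e then q ^ fmaj w * box_sum (q\<^sup>2) (length w) ((a + e - 1 - fdes w) div 2) else 0)" for a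
    using Cons.prems by (intro Cons.IH) (auto simp: e_def)
  have "comp_sum q b (x # w) = (\<Sum>a | a < b \<and> (odd a \<longleftrightarrow> x < 0). q ^ a * comp_sum q (a + e) w)"
    unfolding comp_sum_Cons e_def ..
  also have "\<dots> = (\<Sum>a | a < b \<and> (odd a \<longleftrightarrow> x < 0) \<and> fdes w < a + e.
      q ^ a * (q ^ fmaj w * box_sum (q\<^sup>2) (length w) ((a + e - 1 - fdes w) div 2)))"
    unfolding IH by (rule sum.mono_neutral_cong_right) auto
  also have "{a. a < b \<and> (odd a \<longleftrightarrow> x < 0) \<and> fdes w < a + e} = (\<lambda>k. f + 2 * k) ` {k. f + 2 * k < b}"
  proof (intro equalityI subsetI)
    fix a assume "a \<in> {a. a < b \<and> (odd a \<longleftrightarrow> x < 0) \<and> fdes w < a + e}"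
    then have a: "a < b" "odd a \<longleftrightarrow> odd f" "fdes w < a + e" by (auto simp: odd_f)
    then have "f \<le> a" using f_fw by (elim disjE) presburger+
    moreover from this a(2) have "even (a - f)" by simp
    ultimately show "a \<in> (\<lambda>k. f + 2 * k) ` {k. f + 2 * k < b}"
      using a(1) by (intro image_eqI[of _ _ "(a - f) div 2"]) auto
  next
    fix a assume "a \<in> (\<lambda>k. f + 2 * k) ` {k. f + 2 * k < b}"
    then show "a \<in> {a. a < b \<and> (odd a \<longleftrightarrow> x < 0) \<and> fdes w < a + e}"
      using f_fw odd_f by auto
  qed
  also have "(\<Sum>a\<in>\<dots>. q ^ a * (q ^ fmaj w * box_sum (q\<^sup>2) (length w) ((a + e - 1 - fdes w) div 2))) =
      (\<Sum>k | f + 2 * k < b. q ^ (f + fmaj w) * ((q\<^sup>2) ^ k * box_sum (q\<^sup>2) (length w) k))"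
  proof (subst sum.reindex)
    \<comment> \<open>The two possible values of \<open>f + e\<close> differ by 1, which the halving
      absorbs.\<close>
    have "(f + 2 * k + e - 1 - fdes w) div 2 = k" for k using f_fw by (elim disjE) auto
    then show "(\<Sum>k | f + 2 * k < b. ((\<lambda>a. q ^ a * (q ^ fmaj w *
        box_sum (q\<^sup>2) (length w) ((a + e - 1 - fdes w) div 2))) \<circ> (\<lambda>k. f + 2 * k)) k) =
      (\<Sum>k | f + 2 * k < b. q ^ (f + fmaj w) * ((q\<^sup>2) ^ k * box_sum (q\<^sup>2) (length w) k))"
      by (simp add: power_add mult_ac flip: power_mult)
  qed (auto simp: inj_on_def)
  also have "\<dots> = (if f < b then q ^ (f + fmaj w) * box_sum (q\<^sup>2) (Suc (length w)) ((b - 1 - f) div 2) else 0)"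
  proof (cases "f < b")
    case True
    then have "{k. f + 2 * k < b} = {..(b - 1 - f) div 2}" by auto
    with True show ?thesis by (simp add: sum_distrib_left)
  qed auto
  finally show ?case by (simp add: f_def fmaj_Cons add.commute)
qed

text \<open>By the halving in \<open>comp_sum_eq\<close> each value of \<open>box_sum\<close> serves
  two consecutive \<open>s\<close>; this is the origin of the factor
  \<open>1 + fps_X\<close>.\<close>

lemma comp_sum_series:
  fixes q :: "'b::comm_ring_1"
  assumes "distinct w" "0 \<notin> set w"
  shows "Abs_fps (\<lambda>s. comp_sum q (Suc s) w) * qpoch (fps_X\<^sup>2) ((fps_const q)\<^sup>2) (length w + 1) =
    (1 + fps_X) * fps_X ^ fdes w * fps_const (q ^ fmaj w)"
proof -
  let ?A = "Abs_fps (\<lambda>s. if even s then box_sum (q\<^sup>2) (length w) (s div 2) else 0)"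
  have "Abs_fps (\<lambda>s. comp_sum q (Suc s) w) = fps_const (q ^ fmaj w) * (fps_X ^ fdes w * (?A + fps_X * ?A))"
    (is "_ = _ * (_ * ?C)")
  proof (rule fps_ext)
    fix s
    have C: "?C $ k = box_sum (q\<^sup>2) (length w) (k div 2)" for k
      by (cases k) (auto elim!: oddE)
    show "Abs_fps (\<lambda>s. comp_sum q (Suc s) w) $ s = (fps_const (q ^ fmaj w) * (fps_X ^ fdes w * ?C)) $ s"
      unfolding fps_mult_left_const_nth fps_X_power_mult_nth C using assms
      by (simp add: comp_sum_eq not_less less_Suc_eq_le)
  qed
  also have "\<dots> = (1 + fps_X) * fps_X ^ fdes w * fps_const (q ^ fmaj w) * ?A"
    by (simp add: algebra_simps)
  finally show ?thesis
    using box_series[of "q\<^sup>2" "length w"] by (simp only: mult.assoc fps_const_power mult_1_right)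
qed

section \<open>Words as pairs of a signed permutation and a compatible sequence\<close>

definition pos :: "int \<Rightarrow> nat" where
  "pos x = nat \<bar>x\<bar> - 1"

text \<open>The compatible sequence is obtained by reading \<open>v\<close> in the order that
  \<open>w\<close> prescribes.\<close>

definition arranges :: "int list \<Rightarrow> nat list \<Rightarrow> bool" where
  "arranges w v \<longleftrightarrow> compatible w (map (\<lambda>x. v ! pos x) w)"

lemma upto_eq_map_upt: "[1..int n] = map (\<lambda>k. int k + 1) [0..<n]"
proof (induction n)
  case (Suc n)
  then show ?case using upto_rec2[of 1 "int (Suc n)"] by (simp add: add.commute)
qed simp

text \<open>This form is visibly invariant under reordering, so it passes to a sorted list of
  letters.\<close>

lemma signed_perms_iff:
  "w \<in> signed_perms n \<longleftrightarrow> 0 \<notin> set w \<and> image_mset pos (mset w) = mset [0..<n]"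
proof
  assume w: "w \<in> signed_perms n"
  have "image_mset pos (mset w) = image_mset (\<lambda>y. nat y - 1) (mset (map abs w))"
    by (simp add: pos_def[abs_def] multiset.map_comp comp_def)
  also have "\<dots> = image_mset (\<lambda>y. nat y - 1) (mset (map (\<lambda>k. int k + 1) [0..<n]))"
    using w by (simp add: signed_perms_def upto_eq_map_upt)
  also have "\<dots> = mset [0..<n]"
    by (simp add: multiset.map_comp comp_def nat_add_distrib del: mset_upt)
  finally show "0 \<notin> set w \<and> image_mset pos (mset w) = mset [0..<n]"
    using w by (auto simp: signed_perms_def)
next
  assume w: "0 \<notin> set w \<and> image_mset pos (mset w) = mset [0..<n]"
  have p: "int (pos x) + 1 = \<bar>x\<bar>" if "x \<in> set w" for x
    using that w by (cases "x = 0") (auto simp: pos_def)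
  have "mset (map abs w) = image_mset (\<lambda>k. int k + 1) (image_mset pos (mset w))"
    using p by (auto simp: multiset.map_comp comp_def intro!: image_mset_cong)
  also have "\<dots> = mset [1..int n]"
    using w by (simp add: upto_eq_map_upt del: mset_upt)
  finally have m: "mset (map abs w) = mset [1..int n]" .
  then have "abs ` set w = {1..int n}" by (metis set_map set_mset_mset set_upto)
  moreover from this have "\<bar>x\<bar> \<in> {1..int n}" if "x \<in> set w" for x using that by blast
  ultimately have "set w \<subseteq> {- int n..-1} \<union> {1..int n}" by (fastforce simp: abs_if split: if_splits)
  with m show "w \<in> signed_perms n" by (simp add: signed_perms_def)
qed

lemma signed_permsD:
  assumes "w \<in> signed_perms n"
  shows "length w = n" "distinct w" "0 \<notin> set w" "bij_betw (\<lambda>i. pos (w ! i)) {..<n} {..<n}"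
proof -
  from assms have w: "0 \<notin> set w" "mset (map pos w) = mset [0..<n]"
    by (simp_all add: signed_perms_iff)
  from w(1) show "0 \<notin> set w" .
  show len: "length w = n" using mset_eq_length[OF w(2)] by simp
  have d: "distinct (map pos w)" using mset_eq_imp_distinct_iff[OF w(2)] by simp
  then show "distinct w" by (simp add: distinct_map)
  have "set (map pos w) = {..<n}" using mset_eq_setD[OF w(2)] by (simp add: atLeast0LessThan)
  then have "bij_betw ((!) (map pos w)) {..<n} {..<n}"
    by (intro bij_betw_nth[OF d]) (simp_all add: len)
  moreover have "map pos w ! i = pos (w ! i)" if "i \<in> {..<n}" for i using that len by simp
  ultimately show "bij_betw (\<lambda>i. pos (w ! i)) {..<n} {..<n}"
    by (simp only: bij_betw_cong[of "{..<n}" "(!) (map pos w)" "\<lambda>i. pos (w ! i)"])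
qed

lemma finite_signed_perms [simp]: "finite (signed_perms n)"
proof (rule finite_subset)
  show "signed_perms n \<subseteq> {w. set w \<subseteq> {- int n..int n} \<and> length w = n}"
    using signed_permsD(1) by (auto simp: signed_perms_def)
qed (simp add: finite_lists_length_eq)

text \<open>Reading words of length \<open>n\<close> in the order given by \<open>w\<close> permutes
  them and preserves their sums; the arranged ones become the compatible sequences with entries at
  most \<open>s\<close>.\<close>

lemma sum_arranged:
  assumes w: "w \<in> signed_perms n"
  shows "(\<Sum>v | v \<in> words s n \<and> arranges w v. q ^ sum_list v) = comp_sum q (Suc s) w"
proof -
  note wD = signed_permsD[OF w]
  define \<tau> where "\<tau> v = map (\<lambda>x. v ! pos x) w" for v :: "nat list"
  have nth: "\<tau> v ! i = v ! pos (w ! i)" if "i < n" for v i using that wD(1) by (simp add: \<tau>_def)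
  have lt: "pos (w ! i) < n" if "i < n" for i using bij_betwE[OF wD(4)] that by auto
  have inj: "inj_on \<tau> (words s n)"
  proof (rule inj_onI)
    fix v v' assume v: "v \<in> words s n" "v' \<in> words s n" "\<tau> v = \<tau> v'"
    show "v = v'"
    proof (rule nth_equalityI)
      fix k assume "k < length v"
      then have "k \<in> (\<lambda>i. pos (w ! i)) ` {..<n}"
        using bij_betw_imp_surj_on[OF wD(4)] v(1) by (simp add: words_def)
      then show "v ! k = v' ! k" using v(3) nth[of _ v] nth[of _ v'] by auto
    qed (use v in \<open>simp add: words_def\<close>)
  qed
  have "\<tau> ` words s n \<subseteq> words s n"
  proof
    fix c assume "c \<in> \<tau> ` words s n"
    then obtain v where v: "v \<in> words s n" "c = \<tau> v" by blast
    have "v ! pos x \<le> s" if "x \<in> set w" for x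
    proof -
      from that obtain i where "i < n" "x = w ! i" using wD(1) by (auto simp: in_set_conv_nth)
      then have "pos x < length v" using lt v(1) by (simp add: words_def)
      then have "v ! pos x \<in> set v" by simp
      then show ?thesis using v(1) by (auto simp: words_def)
    qed
    then show "c \<in> words s n" using v wD(1) by (auto simp: words_def \<tau>_def)
  qed
  then have surj: "\<tau> ` words s n = words s n" by (intro endo_inj_surj inj) simp_all
  have sum: "sum_list (\<tau> v) = sum_list v" if "v \<in> words s n" for v
  proof -
    have "sum_list (\<tau> v) = (\<Sum>i<n. v ! pos (w ! i))"
      using wD(1) nth[of _ v] by (simp add: sum_list_sum_nth \<tau>_def atLeast0LessThan)
    also have "\<dots> = (\<Sum>k<n. v ! k)" by (rule sum.reindex_bij_betw[OF wD(4)])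
    finally show ?thesis using that by (simp add: sum_list_sum_nth words_def atLeast0LessThan)
  qed
  have "comps (Suc s) w = {c \<in> words s n. compatible w c}"
    using wD(1) by (auto simp: comps_def words_def compatible_def list_all2_lengthD less_Suc_eq_le)
  also have "\<dots> = \<tau> ` {v \<in> words s n. arranges w v}"
    using surj by (auto simp: arranges_def \<tau>_def[symmetric])
  finally have "comp_sum q (Suc s) w = (\<Sum>c\<in>\<tau> ` {v \<in> words s n. arranges w v}. q ^ sum_list c)"
    by (simp add: comp_sum_def)
  also have "\<dots> = (\<Sum>v | v \<in> words s n \<and> arranges w v. q ^ sum_list v)"
    by (subst sum.reindex) (auto simp: sum intro: inj_on_subset[OF inj])
  finally show ?thesis ..
qed

section \<open>The signed permutation of a word\<close>

lemma arranges_iff: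
  "arranges w v \<longleftrightarrow> (\<forall>x\<in>set w. odd (v ! pos x) \<longleftrightarrow> x < 0) \<and>
     sorted_wrt (<) (map (\<lambda>x. (- int (v ! pos x), x)) w)"
proof -
  have "zip (map (\<lambda>a. - int a) (map (\<lambda>x. v ! pos x) w)) w = map (\<lambda>x. (- int (v ! pos x), x)) w"
    by (induction w) simp_all
  moreover have "list_all2 (\<lambda>a x. odd a \<longleftrightarrow> x < 0) (map (\<lambda>x. v ! pos x) w) w \<longleftrightarrow>
      (\<forall>x\<in>set w. odd (v ! pos x) \<longleftrightarrow> x < 0)"
    by (induction w) simp_all
  ultimately show ?thesis by (simp only: arranges_def compatible_def)
qed

lemma pos_signed_letter [simp]: "pos (signed_letter v k) = k"
  by (simp add: pos_def signed_letter_def nat_add_distrib)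

lemma signed_letter_pos:
  assumes "arranges w v" "x \<in> set w" "0 \<notin> set w"
  shows "signed_letter v (pos x) = x"
proof -
  have "x \<noteq> 0" "odd (v ! pos x) \<longleftrightarrow> x < 0" using assms by (auto simp: arranges_iff)
  then show ?thesis by (auto simp: signed_letter_def pos_def)
qed

text \<open>The parities in \<open>v\<close> force the signs, hence the set of letters, and strict
  increase of an injective key forces their order: \<open>w\<close> must be the sorted list.\<close>

lemma arranges_unique:
  assumes "length v = n"
  shows "\<exists>!w. w \<in> signed_perms n \<and> arranges w v"
proof -
  define L where "L = map (signed_letter v) [0..<n]"
  define key where "key x = (- int (v ! pos x), x)" for x
  have inj: "inj_on key A" for A by (auto simp: inj_on_def key_def)
  have "inj_on (signed_letter v) A" for A by (rule inj_on_inverseI[of _ pos]) simp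
  then have dL: "distinct L" by (simp add: L_def distinct_map)
  show ?thesis
  proof (rule ex1I[of _ "sort_key key L"])
    have "image_mset pos (mset L) = mset [0..<n]"
      by (simp add: L_def multiset.map_comp comp_def del: mset_upt)
    moreover have "0 \<notin> set L" by (auto simp: L_def signed_letter_def split: if_splits)
    ultimately have "sort_key key L \<in> signed_perms n" by (simp add: signed_perms_iff)
    moreover have "\<forall>x\<in>set (sort_key key L). odd (v ! pos x) \<longleftrightarrow> x < 0"
      by (auto simp: L_def) (auto simp: signed_letter_def split: if_splits)
    moreover have "sorted_wrt (<) (map key (sort_key key L))"
      using dL inj by (simp add: strict_sorted_iff distinct_map)
    ultimately show "sort_key key L \<in> signed_perms n \<and> arranges (sort_key key L) v"
      by (simp add: arranges_iff key_def[symmetric])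
  next
    fix w assume w: "w \<in> signed_perms n \<and> arranges w v"
    then have "0 \<notin> set w" "image_mset pos (mset w) = mset [0..<n]" by (simp_all add: signed_perms_iff)
    have "mset w = image_mset (\<lambda>x. signed_letter v (pos x)) (mset w)"
      using w signed_letter_pos[of w v] \<open>0 \<notin> set w\<close>
      by (metis (mono_tags, lifting) image_mset_cong multiset.map_ident set_mset_mset)
    also have "\<dots> = image_mset (signed_letter v) (image_mset pos (mset w))"
      by (simp add: multiset.map_comp comp_def)
    also have "\<dots> = mset L" by (simp add: \<open>image_mset pos (mset w) = mset [0..<n]\<close> L_def del: mset_upt)
    finally have "mset L = mset w" ..
    moreover have "sorted (map key w)"
      using w by (simp add: arranges_iff key_def[abs_def] strict_sorted_iff)
    ultimately show "w = sort_key key L"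
      using sort_key_inj_key_eq[OF _ inj, of L w] by simp
  qed
qed

text \<open>The positions named by \<open>w\<close> occur in increasing order of
  \<open>pos_key\<close>, so exactly \<open>i\<close> of them precede the one at index
  \<open>i\<close>.\<close>

lemma rank_arranged:
  assumes w: "w \<in> signed_perms n" and v: "length v = n" "arranges w v" and i: "i < n"
  shows "rank v (pos (w ! i)) = i"
proof -
  note wD = signed_permsD[OF w]
  have key: "pos_key v (pos (w ! j)) = (- int (v ! pos (w ! j)), w ! j)" if "j < n" for j
    using signed_letter_pos[OF v(2) _ wD(3)] that wD(1) by (simp add: pos_key_def)
  have mono: "pos_key v (pos (w ! j)) < pos_key v (pos (w ! k))" if "j < k" "k < n" for j k
    using v(2) that wD(1) sorted_wrt_nth_less[of "(<)" "map (\<lambda>x. (- int (v ! pos x), x)) w" j k]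
    by (simp add: arranges_iff key del: less_prod_simp)
  have iff: "pos_key v (pos (w ! j)) < pos_key v (pos (w ! i)) \<longleftrightarrow> j < i" if "j < n" for j
    using mono[of j i] mono[of i j] that i by (metis linorder_neqE_nat order_less_asym order_less_irrefl)
  have "{k. k < length v \<and> pos_key v k < pos_key v (pos (w ! i))} =
      {k \<in> (\<lambda>j. pos (w ! j)) ` {..<n}. pos_key v k < pos_key v (pos (w ! i))}"
    using v(1) bij_betw_imp_surj_on[OF wD(4)] by auto
  also have "\<dots> = (\<lambda>j. pos (w ! j)) ` {..<i}"
    using iff i by auto
  finally have "rank v (pos (w ! i)) = card ((\<lambda>j. pos (w ! j)) ` {..<i})" by (simp add: rank_def)
  also have "\<dots> = i"
    using bij_betw_imp_inj_on[OF wD(4)] i by (subst card_image) (auto intro: inj_on_subset)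
  finally show ?thesis .
qed

lemma card_letters:
  "card {i \<in> {1..length w}. P (letter w i) i} = card {i. i < length w \<and> P (w ! i) (Suc i)}"
proof -
  have "{i \<in> {1..length w}. P (letter w i) i} = Suc ` {i. i < length w \<and> P (w ! i) (Suc i)}"
  proof (rule set_eqI)
    fix i show "i \<in> {i \<in> {1..length w}. P (letter w i) i} \<longleftrightarrow>
        i \<in> Suc ` {i. i < length w \<and> P (w ! i) (Suc i)}"
      by (cases i) (auto simp: letter_def)
  qed
  then show ?thesis by (simp add: card_image)
qed

lemma prod_if_one: "(\<Prod>i<n::nat. if P i then c else 1) = (c :: 'b::comm_ring_1) ^ card {i. i < n \<and> P i}"
proof -
  have "(\<Prod>i<n. if P i then c else 1) = (\<Prod>i | i < n \<and> P i. c)"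
    using prod.inter_filter[of "{..<n}" "\<lambda>_. c" P] by simp
  then show ?thesis by simp
qed

text \<open>Reindexing by \<open>k = pos (w ! i)\<close> turns \<open>rank v k = k\<close> into
  \<open>i = pos (w ! i)\<close>, a fixed point of \<open>w\<close> up to sign, and the parity of
  the entry decides the sign.\<close>

lemma weight_arranged:
  fixes q Y0 Y1 Z :: "'b::comm_ring_1"
  assumes w: "w \<in> signed_perms n" and v: "length v = n" "arranges w v"
  shows "weight (\<lambda>a. q ^ a * Z ^ of_bool (odd a)) (\<lambda>a. if even a then Y0 else Y1) v =
    q ^ sum_list v * (Y0 ^ fix_plus w * Y1 ^ fix_minus w * Z ^ neg w)"
proof -
  note wD = signed_permsD[OF w]
  have "weight (\<lambda>a. q ^ a * Z ^ of_bool (odd a)) (\<lambda>a. if even a then Y0 else Y1) v =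
      (\<Prod>i<n. q ^ (v ! pos (w ! i)) * Z ^ of_bool (odd (v ! pos (w ! i))) *
         (if rank v (pos (w ! i)) = pos (w ! i) then if even (v ! pos (w ! i)) then Y0 else Y1 else 1))"
    unfolding weight_def v(1) by (rule prod.reindex_bij_betw[OF wD(4), symmetric])
  also have "\<dots> = (\<Prod>i<n. q ^ (v ! pos (w ! i)) * (if w ! i = int (Suc i) then Y0 else 1) *
      (if w ! i = - int (Suc i) then Y1 else 1) * (if w ! i < 0 then Z else 1))"
  proof (rule prod.cong)
    fix i assume "i \<in> {..<n}"
    then have i: "i < n" by simp
    then have "w ! i \<in> set w" using wD(1) by simp
    then have "odd (v ! pos (w ! i)) \<longleftrightarrow> w ! i < 0" "w ! i \<noteq> 0"
      using v(2) wD(3) by (auto simp: arranges_iff)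
    moreover from this have "i = pos (w ! i) \<longleftrightarrow> w ! i = int (Suc i) \<or> w ! i = - int (Suc i)"
      by (auto simp: pos_def)
    ultimately show "q ^ (v ! pos (w ! i)) * Z ^ of_bool (odd (v ! pos (w ! i))) *
         (if rank v (pos (w ! i)) = pos (w ! i) then if even (v ! pos (w ! i)) then Y0 else Y1 else 1) =
      q ^ (v ! pos (w ! i)) * (if w ! i = int (Suc i) then Y0 else 1) *
        (if w ! i = - int (Suc i) then Y1 else 1) * (if w ! i < 0 then Z else 1)"
      using rank_arranged[OF w v i] by auto
  qed simp
  also have "\<dots> = q ^ (\<Sum>i<n. v ! pos (w ! i)) * Y0 ^ fix_plus w * Y1 ^ fix_minus w * Z ^ neg w"
    using card_letters[of w "\<lambda>x i. x = int i"] card_letters[of w "\<lambda>x i. x = - int i"]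
      card_letters[of w "\<lambda>x i. x < 0"]
    by (simp only: prod.distrib prod_if_one power_sum fix_plus_def fix_minus_def neg_def wD(1))
  also have "(\<Sum>i<n. v ! pos (w ! i)) = sum_list v"
    using sum.reindex_bij_betw[OF wD(4), of "(!) v"] v(1) by (simp add: sum_list_sum_nth atLeast0LessThan)
  finally show ?thesis by (simp add: mult_ac)
qed

text \<open>Double counting of the pairs of a word and the one signed permutation that arranges
  it.\<close>

lemma word_sum_eq_signed_perms:
  fixes q Y0 Y1 Z :: "'b::comm_ring_1"
  shows "word_sum s (\<lambda>a. q ^ a * Z ^ of_bool (odd a)) (\<lambda>a. if even a then Y0 else Y1) n =
    (\<Sum>w\<in>signed_perms n. comp_sum q (Suc s) w * (Y0 ^ fix_plus w * Y1 ^ fix_minus w * Z ^ neg w))"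
proof -
  let ?W = "weight (\<lambda>a. q ^ a * Z ^ of_bool (odd a)) (\<lambda>a. if even a then Y0 else Y1)"
  have "(\<Sum>w | w \<in> signed_perms n \<and> arranges w v. ?W v) = ?W v" if "v \<in> words s n" for v
  proof -
    have "length v = n" using that by (simp add: words_def)
    from arranges_unique[OF this] obtain w where
      "w \<in> signed_perms n \<and> arranges w v" "\<And>w'. w' \<in> signed_perms n \<and> arranges w' v \<Longrightarrow> w' = w"
      by blast
    then have "{w. w \<in> signed_perms n \<and> arranges w v} = {w}" by blast
    then show ?thesis by simp
  qed
  then have "word_sum s (\<lambda>a. q ^ a * Z ^ of_bool (odd a)) (\<lambda>a. if even a then Y0 else Y1) n =
      (\<Sum>v\<in>words s n. \<Sum>w | w \<in> signed_perms n \<and> arranges w v. ?W v)"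
    by (simp add: word_sum_def)
  also have "\<dots> = (\<Sum>w\<in>signed_perms n. \<Sum>v | v \<in> words s n \<and> arranges w v. ?W v)"
    by (rule sum.swap_restrict) simp_all
  also have "\<dots> = (\<Sum>w\<in>signed_perms n. \<Sum>v | v \<in> words s n \<and> arranges w v.
      q ^ sum_list v * (Y0 ^ fix_plus w * Y1 ^ fix_minus w * Z ^ neg w))"
    by (intro sum.cong) (auto simp: weight_arranged words_def)
  also have "\<dots> = (\<Sum>w\<in>signed_perms n. comp_sum q (Suc s) w *
      (Y0 ^ fix_plus w * Y1 ^ fix_minus w * Z ^ neg w))"
    by (simp add: sum_arranged flip: sum_distrib_right)
  finally show ?thesis .
qed

section \<open>Assembling the generating function\<close>

text \<open>Meant for series whose coefficients are again power series and form no field; constant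
  term 1 makes them invertible.\<close>

lemma inverse_mult_unit:
  fixes f :: "'b::{comm_ring_1, inverse} fps"
  assumes "f $ 0 = 1" "inverse 1 = (1 :: 'b)"
  shows "f * inverse f = 1"
  using fps_right_inverse[of f "inverse (f $ 0)"] assms by (simp add: fps_inverse_def)

text \<open>Among \<open>0, ..., s\<close> there are \<open>s div 2 + 1\<close> even and
  \<open>(s + 1) div 2\<close> odd numbers, which explains the lengths of the q-Pochhammer
  symbols.\<close>

lemma prod_split_parity:
  fixes f g :: "nat \<Rightarrow> 'b::comm_ring_1"
  shows "(\<Prod>a\<le>s. if even a then f (a div 2) else g (a div 2)) =
    (\<Prod>k<s div 2 + 1. f k) * (\<Prod>k<(s + 1) div 2. g k)"
proof (induction s)
  case (Suc s)
  then show ?case by (cases "even s") (auto elim!: evenE oddE simp: mult_ac)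
qed simp

lemma qpoch_nth_0: "a $ 0 = 0 \<Longrightarrow> qpoch a (r :: 'b::comm_ring_1 fps) n $ 0 = 1"
  by (induction n) (simp_all add: qpoch_def)

lemma word_sum_const:
  "word_sum s (\<lambda>a. fps_const (x a)) (\<lambda>a. fps_const (y a)) n = fps_const (word_sum s x y n)"
proof -
  have "(\<Prod>k<m. fps_const (g k)) = fps_const (\<Prod>k<m. g k)" for g :: "nat \<Rightarrow> 'a" and m
    by (induction m) simp_all
  moreover have "fps_const (x a) * (if P then fps_const (y a) else 1) =
      fps_const (x a * (if P then y a else 1))" for a P
    by simp
  ultimately have "weight (\<lambda>a. fps_const (x a)) (\<lambda>a. fps_const (y a)) v = fps_const (weight x y v)" for v
    by (simp only: weight_def)
  moreover have "(\<Sum>v\<in>A. fps_const (g v)) = fps_const (\<Sum>v\<in>A. g v)" for g :: "nat list \<Rightarrow> 'a" and A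
    by (induction A rule: infinite_finite_induct) simp_all
  ultimately show ?thesis by (simp add: word_sum_def)
qed

text \<open>This is \<open>word_series\<close> over the coefficient ring of power series in
  \<open>t\<close>, with constant parameters and \<open>fps_X\<close> as \<open>u\<close>, solved
  for the word series.\<close>

lemma rhs_term_nth:
  fixes q Y0 Y1 Z :: "'a::field"
  shows "rhs_term q Y0 Y1 Z s $ n = fps_X ^ s * fps_const
    (word_sum s (\<lambda>a. q ^ a * Z ^ of_bool (odd a)) (\<lambda>a. if even a then Y0 else Y1) n)"
proof -
  define x where "x a = fps_const (q ^ a * Z ^ of_bool (odd a))" for a :: nat
  define y where "y a = fps_const (if even a then Y0 else Y1)" for a :: nat
  let ?Q = "(scalar q)\<^sup>2"
  define W where "W = Abs_fps (word_sum s x y)"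
  define D where "D = 1 - var_u * (\<Sum>i=0..s. scalar q ^ i * scalar Z ^ of_bool (odd i))"
  define Ne De where "Ne = qpoch var_u ?Q (s div 2 + 1)"
    and "De = qpoch (var_u * scalar Y0) ?Q (s div 2 + 1)"
  define No Do where "No = qpoch (- var_u * scalar q * scalar Y1 * scalar Z) ?Q ((s + 1) div 2)"
    and "Do = qpoch (- var_u * scalar q * scalar Z) ?Q ((s + 1) div 2)"
  have sc: "scalar a * scalar b = scalar (a * b)" "scalar a ^ k = scalar (a ^ k)" for a b :: 'a and k
    by (simp_all add: scalar_def fps_const_power)
  have x: "fps_const (x a) = scalar (q ^ a * Z ^ of_bool (odd a))" for a by (simp add: x_def scalar_def)
  have y: "fps_const (y a) = scalar (if even a then Y0 else Y1)" for a by (simp add: y_def scalar_def)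
  have "fps_const (\<Sum>a\<le>m. x a) = (\<Sum>a\<le>m. fps_const (x a))" for m
    by (induction m) (simp_all flip: fps_const_add)
  then have "fps_const (\<Sum>a\<le>s. x a) = (\<Sum>i=0..s. scalar q ^ i * scalar Z ^ of_bool (odd i))"
    by (simp only: x sc atMost_atLeast0)
  then have D: "1 - fps_const (\<Sum>a\<le>s. x a) * fps_X = D" by (simp add: D_def var_u_def mult.commute)
  have den: "(\<Prod>a\<le>s. den_factor x y a) = De * Do"
  proof -
    \<comment> \<open>Writing \<open>a\<close> as \<open>2 * k\<close> or \<open>2 * k + 1\<close>
      turns \<open>q ^ a\<close> into \<open>(q^2) ^ k\<close> or \<open>q * (q^2) ^ k\<close>, the
      shape of a q-Pochhammer factor.\<close>
    have "den_factor x y a =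
        (if even a then 1 - var_u * scalar Y0 * ?Q ^ (a div 2)
         else 1 - - var_u * scalar q * scalar Z * ?Q ^ (a div 2))" for a
      unfolding den_factor_def fps_const_mult[symmetric] x y var_u_def sc
      by (auto elim!: evenE oddE simp: mult_ac sc simp flip: power_mult)
    then show ?thesis by (simp only: De_def Do_def qpoch_def prod_split_parity[symmetric])
  qed
  have num: "(\<Prod>a\<le>s. num_factor x y a) = Ne * No"
  proof -
    have "num_factor x y a =
        (if even a then 1 - var_u * ?Q ^ (a div 2)
         else 1 - - var_u * scalar q * scalar Y1 * scalar Z * ?Q ^ (a div 2))" for a
      unfolding num_factor_def fps_const_mult[symmetric] x y var_u_def sc
      by (auto elim!: evenE oddE simp: mult_ac sc simp flip: power_mult)
    then show ?thesis by (simp only: Ne_def No_def qpoch_def prod_split_parity[symmetric])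
  qed
  have W: "W * D * (De * Do) = Ne * No"
    using word_series[of s x y] by (simp only: W_def D den num)
  have "D * inverse D = 1"
    by (rule inverse_mult_unit) (simp_all add: D_def var_u_def)
  moreover have "De * inverse De = 1"
    by (rule inverse_mult_unit) (simp_all add: De_def var_u_def qpoch_nth_0)
  moreover have "Do * inverse Do = 1"
    by (rule inverse_mult_unit) (simp_all add: Do_def var_u_def qpoch_nth_0)
  ultimately have "inverse D * (Ne * inverse De) * (No * inverse Do) = W" using W by algebra
  then have "rhs_term q Y0 Y1 Z s = var_t ^ s * W"
    by (simp only: rhs_term_def D_def Ne_def De_def No_def Do_def mult.assoc)
  moreover have "word_sum s x y n = fps_const
      (word_sum s (\<lambda>a. q ^ a * Z ^ of_bool (odd a)) (\<lambda>a. if even a then Y0 else Y1) n)"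
    unfolding x_def[abs_def] y_def[abs_def] by (rule word_sum_const)
  ultimately show ?thesis by (simp add: W_def var_t_def fps_const_power)
qed

theorem theorem1p3:
  fixes q Y0 Y1 Z :: "'a::field" and B :: "nat \<Rightarrow> 'a fps" and n :: nat
  assumes "gf_identity q Y0 Y1 Z B"
  shows "B n =
    (\<Sum>w\<in>signed_perms n.
       fps_X ^ fdes w * fps_const (q ^ fmaj w * Y0 ^ fix_plus w * Y1 ^ fix_minus w * Z ^ neg w))"
proof -
  let ?g = "\<lambda>w. Y0 ^ fix_plus w * Y1 ^ fix_minus w * Z ^ neg w"
  let ?P = "qpoch (fps_X\<^sup>2) ((fps_const q)\<^sup>2) (n + 1)"
  let ?R = "formal_sum (rhs_term q Y0 Y1 Z) $ n"
  let ?S = "\<Sum>w\<in>signed_perms n.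
       fps_X ^ fdes w * fps_const (q ^ fmaj w * Y0 ^ fix_plus w * Y1 ^ fix_minus w * Z ^ neg w)"
  have "?R = (\<Sum>w\<in>signed_perms n. fps_const (?g w) * Abs_fps (\<lambda>s. comp_sum q (Suc s) w))"
  proof (rule fps_ext)
    fix j
    \<comment> \<open>The coefficient of \<open>u ^ n\<close> in the term of index \<open>k\<close>
      is a constant times \<open>t ^ k\<close>, so \<open>t ^ j\<close> arises from
      \<open>k = j\<close> alone.\<close>
    have "(\<Sum>k. rhs_term q Y0 Y1 Z k $ n $ j) = (\<Sum>k\<in>{j}. rhs_term q Y0 Y1 Z k $ n $ j)"
      by (rule Sum_any.expand_superset) (auto simp: rhs_term_nth)
    then show "?R $ j = (\<Sum>w\<in>signed_perms n. fps_const (?g w) * Abs_fps (\<lambda>s. comp_sum q (Suc s) w)) $ j"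
      by (simp add: formal_sum_def rhs_term_nth word_sum_eq_signed_perms fps_sum_nth mult.commute)
  qed
  then have "?R * ?P = (\<Sum>w\<in>signed_perms n. fps_const (?g w) * (Abs_fps (\<lambda>s. comp_sum q (Suc s) w) * ?P))"
    by (simp only: sum_distrib_right mult.assoc)
  also have "\<dots> = (\<Sum>w\<in>signed_perms n.
      fps_const (?g w) * ((1 + fps_X) * fps_X ^ fdes w * fps_const (q ^ fmaj w)))"
  proof (rule sum.cong)
    fix w assume "w \<in> signed_perms n"
    then show "fps_const (?g w) * (Abs_fps (\<lambda>s. comp_sum q (Suc s) w) * ?P) =
        fps_const (?g w) * ((1 + fps_X) * fps_X ^ fdes w * fps_const (q ^ fmaj w))"
      using comp_sum_series[of w q] signed_permsD[of w n] by simp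
  qed simp
  also have "\<dots> = (1 + fps_X) * ?S"
    unfolding sum_distrib_left by (rule sum.cong) (simp_all only: fps_const_mult[symmetric] mult_ac)
  finally have R: "?R * ?P = (1 + fps_X) * ?S" .
  have P: "?P * inverse ?P = 1"
    by (rule inverse_mult_eq_1') (simp add: qpoch_fps_X_0 del: fps_const_power)
  have "?R = (1 + fps_X) * B n * inverse ?P" using assms by (simp only: gf_identity_iff)
  then have "?R * ?P = (1 + fps_X) * B n * inverse ?P * ?P" by (rule arg_cong)
  also have "\<dots> = (1 + fps_X) * B n * (?P * inverse ?P)" by (simp only: mult_ac)
  finally have "?R * ?P = (1 + fps_X) * B n" by (simp only: P mult_1_right)
  from trans[OF this[symmetric] R] have eq: "(1 + fps_X) * B n = (1 + fps_X) * ?S" .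
  \<comment> \<open>Power series over a field form an integral domain, so the nonzero factor
    \<open>1 + fps_X\<close> cancels.\<close>
  have "(1 + fps_X :: 'a fps) $ 0 \<noteq> 0" by simp
  then have "(1 + fps_X :: 'a fps) \<noteq> 0" by (metis fps_zero_nth)
  from iffD1[OF mult_left_cancel[OF this] eq] show ?thesis .
qed

end
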